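(* Let $\mathbf A$ be a finite algebra with a Taylor term, let $\rho\in\operatorname{Con}(\mathbf A)$ be irreducible, and suppose $\operatorname{Opt}(\rho)=1_A$. Then there exist a simple affine algebra $\mathbf Z\in\mathsf{HS}(\mathbf A^2)$ having a one-element subuniverse $\{0\}\le\mathbf Z$, and a subdirect subuniverse $\zeta\le_{sd}\mathbf A\times\mathbf A\times\mathbf Z$ with $\operatorname{pr}_{1,2}(\zeta)=\rho^*$, such that for all $(a,a',b)\in\zeta$: $(a,a')\in\rho\iff b=0$.
   Context: A Taylor term is an idempotent term $t(x_1,\dots,x_n)$, $n>1$, such that for each $i$ an identity $t(u_1,\dots,u_n)\approx t(v_1,\dots,v_n)$ holds with $u_j,v_k\in\{x,y\}$, $\{u_i,v_i\}=\{x,y\}$. An algebra is affine if it is abelian (for every term $t(x,\bar y)$ and all $a,b,\bar c,\bar d$: $t(a,\bar c)=t(a,\bar d)\Rightarrow t(b,\bar c)=t(b,\bar d)$) and has a Maltsev term. $\le_{sd}$ means a subuniverse projecting onto each factor. For $\rho\in\operatorname{Con}(\mathbf A)\setminus\{1_A\}$: a subuniverse $R\le\mathbf A^2$ is $\rho$-saturated if $R=\rho\circ R\circ\rho$; $\operatorname{Cov}(\rho)$ is the set of minimal (under inclusion) $\rho$-saturated subuniverses of $\mathbf A^2$ properly containing $\rho$; $\rho$ is irreducible if $|\operatorname{Cov}(\rho)|=1$, and then $\rho^*$ denotes its unique member. Bridges: a bridge from $(\mathbf A,\rho)$ to $(\mathbf A,\rho)$ is a subuniverse $T\le\mathbf A^4$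 such that (B0* ) $T$ is closed under replacing any coordinate by a $\rho$-related element; (B1* ) $\rho\subsetneq\operatorname{pr}_{1,2}(T)$ and $\rho\subsetneq\operatorname{pr}_{3,4}(T)$; (B2* ) for $(a_1,a_2,b_1,b_2)\in T$, $(a_1,a_2)\in\rho\iff(b_1,b_2)\in\rho$. Its trace is $\operatorname{tr}(T)=\{(a,b):(a,a,b,b)\in T\}$; it is reflexive if $0_A\subseteq\operatorname{tr}(T)$. For irreducible $\rho$, $\operatorname{Opt}(\rho)$ is the largest member (which exists) of the set of traces of reflexive bridges $T$ from $(\mathbf A,\rho)$ to itself with $\operatorname{pr}_{1,2}(T)=\operatorname{pr}_{3,4}(T)=\rho^*$. *)

theory Defs
  imports Main
begin

text \<open>A signature is an arity function \<open>ar\<close> on a type of operation symbols.  Nullary symbols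
  are allowed; an operation is only meaningful on argument lists of the length given by \<open>ar\<close>.\<close>

record ('f, 'a) alg =
  univ :: "'a set"
  interp :: "'f \<Rightarrow> 'a list \<Rightarrow> 'a"

definition closed_under :: "('f \<Rightarrow> nat) \<Rightarrow> ('f, 'a) alg \<Rightarrow> 'a set \<Rightarrow> bool" where
  "closed_under ar A B \<longleftrightarrow>
     (\<forall>f xs. length xs = ar f \<and> set xs \<subseteq> B \<longrightarrow> interp A f xs \<in> B)"

definition is_algebra :: "('f \<Rightarrow> nat) \<Rightarrow> ('f, 'a) alg \<Rightarrow> bool" where
  "is_algebra ar A \<longleftrightarrow> univ A \<noteq> {} \<and> closed_under ar A (univ A)"

definition subuniverse :: "('f \<Rightarrow> nat) \<Rightarrow> ('f, 'a) alg \<Rightarrow> 'a set \<Rightarrow> bool" where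
  "subuniverse ar A B \<longleftrightarrow> B \<subseteq> univ A \<and> closed_under ar A B"

definition prod_alg :: "('f, 'a) alg \<Rightarrow> ('f, 'b) alg \<Rightarrow> ('f, 'a \<times> 'b) alg"  (infixr "\<otimes>" 70) where
  "A \<otimes> B = \<lparr>univ = univ A \<times> univ B,
            interp = (\<lambda>f xs. (interp A f (map fst xs), interp B f (map snd xs)))\<rparr>"

definition is_hom :: "('f \<Rightarrow> nat) \<Rightarrow> ('f, 'a) alg \<Rightarrow> ('f, 'b) alg \<Rightarrow> ('a \<Rightarrow> 'b) \<Rightarrow> bool" where
  "is_hom ar A B h \<longleftrightarrow>
     h ` univ A \<subseteq> univ B \<and>
     (\<forall>f xs. length xs = ar f \<and> set xs \<subseteq> univ A \<longrightarrow>
        h (interp A f xs) = interp B f (map h xs))"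

text \<open>\<open>in_HS ar C Z\<close>: \<open>Z\<close> is a homomorphic image of a subalgebra of \<open>C\<close>.\<close>

definition in_HS :: "('f \<Rightarrow> nat) \<Rightarrow> ('f, 'a) alg \<Rightarrow> ('f, 'b) alg \<Rightarrow> bool" where
  "in_HS ar C Z \<longleftrightarrow>
     is_algebra ar Z \<and>
     (\<exists>B h. subuniverse ar C B \<and> is_hom ar (C\<lparr>univ := B\<rparr>) Z h \<and> h ` B = univ Z)"

datatype 'f trm = Var nat | App 'f "'f trm list"

text \<open>\<open>wf_trm ar n t\<close>: \<open>t\<close> respects the arities and its variables are among the first \<open>n\<close>,
  counting from \<open>0\<close>; that is, \<open>t\<close> may be written with \<open>n\<close> arguments.\<close>

fun wf_trm :: "('f \<Rightarrow> nat) \<Rightarrow> nat \<Rightarrow> 'f trm \<Rightarrow> bool" where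
  "wf_trm ar n (Var i) \<longleftrightarrow> i < n"
| "wf_trm ar n (App f ts) \<longleftrightarrow> length ts = ar f \<and> (\<forall>t\<in>set ts. wf_trm ar n t)"

fun term_op :: "('f, 'a) alg \<Rightarrow> 'f trm \<Rightarrow> 'a list \<Rightarrow> 'a" where
  "term_op A (Var i) xs = xs ! i"
| "term_op A (App f ts) xs = interp A f (map (\<lambda>t. term_op A t xs) ts)"

text \<open>In the Taylor identities the variables \<open>x\<close>, \<open>y\<close> are coded as \<open>0\<close>, \<open>1\<close>, so that
  \<open>[x, y] ! k\<close> is the value of the variable coded by \<open>k\<close>.\<close>

definition taylor_term :: "('f \<Rightarrow> nat) \<Rightarrow> ('f, 'a) alg \<Rightarrow> nat \<Rightarrow> 'f trm \<Rightarrow> bool" where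
  "taylor_term ar A n t \<longleftrightarrow>
     n > 1 \<and> wf_trm ar n t \<and>
     (\<forall>x\<in>univ A. term_op A t (replicate n x) = x) \<and>
     (\<forall>i<n. \<exists>u v :: nat list.
        length u = n \<and> length v = n \<and> set u \<subseteq> {0, 1} \<and> set v \<subseteq> {0, 1} \<and>
        {u ! i, v ! i} = {0, 1} \<and>
        (\<forall>x\<in>univ A. \<forall>y\<in>univ A.
           term_op A t (map (\<lambda>k. [x, y] ! k) u) = term_op A t (map (\<lambda>k. [x, y] ! k) v)))"

definition has_taylor_term :: "('f \<Rightarrow> nat) \<Rightarrow> ('f, 'a) alg \<Rightarrow> bool" where
  "has_taylor_term ar A \<longleftrightarrow> (\<exists>n t. taylor_term ar A n t)"

definition abelian :: "('f \<Rightarrow> nat) \<Rightarrow> ('f, 'a) alg \<Rightarrow> bool" where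
  "abelian ar A \<longleftrightarrow>
     (\<forall>n t. wf_trm ar (Suc n) t \<longrightarrow>
        (\<forall>a\<in>univ A. \<forall>b\<in>univ A. \<forall>cs ds.
           length cs = n \<and> length ds = n \<and> set cs \<subseteq> univ A \<and> set ds \<subseteq> univ A \<longrightarrow>
           term_op A t (a # cs) = term_op A t (a # ds) \<longrightarrow>
           term_op A t (b # cs) = term_op A t (b # ds)))"

definition maltsev_term :: "('f \<Rightarrow> nat) \<Rightarrow> ('f, 'a) alg \<Rightarrow> 'f trm \<Rightarrow> bool" where
  "maltsev_term ar A p \<longleftrightarrow>
     wf_trm ar 3 p \<and>
     (\<forall>x\<in>univ A. \<forall>y\<in>univ A. term_op A p [x, y, y] = x \<and> term_op A p [y, y, x] = x)"

definition affine :: "('f \<Rightarrow> nat) \<Rightarrow> ('f, 'a) alg \<Rightarrow> bool" where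
  "affine ar A \<longleftrightarrow> abelian ar A \<and> (\<exists>p. maltsev_term ar A p)"

definition Con :: "('f \<Rightarrow> nat) \<Rightarrow> ('f, 'a) alg \<Rightarrow> ('a \<times> 'a) set set" where
  "Con ar A = {\<theta>. equiv (univ A) \<theta> \<and> subuniverse ar (A \<otimes> A) \<theta>}"

abbreviation zero_con :: "('f, 'a) alg \<Rightarrow> ('a \<times> 'a) set" where
  "zero_con A \<equiv> Id_on (univ A)"

abbreviation one_con :: "('f, 'a) alg \<Rightarrow> ('a \<times> 'a) set" where
  "one_con A \<equiv> univ A \<times> univ A"

text \<open>One-element algebras are not simple.\<close>

definition simple_alg :: "('f \<Rightarrow> nat) \<Rightarrow> ('f, 'a) alg \<Rightarrow> bool" where
  "simple_alg ar A \<longleftrightarrow> zero_con A \<noteq> one_con A \<and> Con ar A = {zero_con A, one_con A}"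

definition saturated :: "('a \<times> 'a) set \<Rightarrow> ('a \<times> 'a) set \<Rightarrow> bool" where
  "saturated \<rho> R \<longleftrightarrow> R = \<rho> O R O \<rho>"

definition Cov :: "('f \<Rightarrow> nat) \<Rightarrow> ('f, 'a) alg \<Rightarrow> ('a \<times> 'a) set \<Rightarrow> ('a \<times> 'a) set set" where
  "Cov ar A \<rho> =
     (let \<S> = {R. subuniverse ar (A \<otimes> A) R \<and> saturated \<rho> R \<and> \<rho> \<subset> R}
      in {R \<in> \<S>. \<forall>S\<in>\<S>. \<not> S \<subset> R})"

definition irreducible_con :: "('f \<Rightarrow> nat) \<Rightarrow> ('f, 'a) alg \<Rightarrow> ('a \<times> 'a) set \<Rightarrow> bool" where
  "irreducible_con ar A \<rho> \<longleftrightarrow> \<rho> \<in> Con ar A - {one_con A} \<and> card (Cov ar A \<rho>) = 1"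

text \<open>\<open>\<rho>\<^sup>*\<close>; meaningful when \<open>\<rho>\<close> is irreducible.\<close>

definition star :: "('f \<Rightarrow> nat) \<Rightarrow> ('f, 'a) alg \<Rightarrow> ('a \<times> 'a) set \<Rightarrow> ('a \<times> 'a) set" where
  "star ar A \<rho> = the_elem (Cov ar A \<rho>)"

definition pr12 :: "('a \<times> 'b \<times> 'c) set \<Rightarrow> ('a \<times> 'b) set" where
  "pr12 T = (\<lambda>(a, b, c). (a, b)) ` T"

definition pr34 :: "('a \<times> 'b \<times> 'c \<times> 'd) set \<Rightarrow> ('c \<times> 'd) set" where
  "pr34 T = (\<lambda>(a, b, c, d). (c, d)) ` T"

definition bridge ::
  "('f \<Rightarrow> nat) \<Rightarrow> ('f, 'a) alg \<Rightarrow> ('a \<times> 'a) set \<Rightarrow> ('a \<times> 'a \<times> 'a \<times> 'a) set \<Rightarrow> bool" where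
  "bridge ar A \<rho> T \<longleftrightarrow>
     subuniverse ar (A \<otimes> A \<otimes> A \<otimes> A) T \<and>
     (\<forall>a\<^sub>1 a\<^sub>2 b\<^sub>1 b\<^sub>2 c. (a\<^sub>1, a\<^sub>2, b\<^sub>1, b\<^sub>2) \<in> T \<longrightarrow>
        ((a\<^sub>1, c) \<in> \<rho> \<longrightarrow> (c, a\<^sub>2, b\<^sub>1, b\<^sub>2) \<in> T) \<and>
        ((a\<^sub>2, c) \<in> \<rho> \<longrightarrow> (a\<^sub>1, c, b\<^sub>1, b\<^sub>2) \<in> T) \<and>
        ((b\<^sub>1, c) \<in> \<rho> \<longrightarrow> (a\<^sub>1, a\<^sub>2, c, b\<^sub>2) \<in> T) \<and>
        ((b\<^sub>2, c) \<in> \<rho> \<longrightarrow> (a\<^sub>1, a\<^sub>2, b\<^sub>1, c) \<in> T)) \<and>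
     \<rho> \<subset> pr12 T \<and> \<rho> \<subset> pr34 T \<and>
     (\<forall>a\<^sub>1 a\<^sub>2 b\<^sub>1 b\<^sub>2. (a\<^sub>1, a\<^sub>2, b\<^sub>1, b\<^sub>2) \<in> T \<longrightarrow> ((a\<^sub>1, a\<^sub>2) \<in> \<rho> \<longleftrightarrow> (b\<^sub>1, b\<^sub>2) \<in> \<rho>))"

definition tr :: "('a \<times> 'a \<times> 'a \<times> 'a) set \<Rightarrow> ('a \<times> 'a) set" where
  "tr T = {(a, b). (a, a, b, b) \<in> T}"

definition Opt :: "('f \<Rightarrow> nat) \<Rightarrow> ('f, 'a) alg \<Rightarrow> ('a \<times> 'a) set \<Rightarrow> ('a \<times> 'a) set" where
  "Opt ar A \<rho> =
     (GREATEST S. \<exists>T. S = tr T \<and> bridge ar A \<rho> T \<and> zero_con A \<subseteq> tr T \<and>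
        pr12 T = star ar A \<rho> \<and> pr34 T = star ar A \<rho>)"

text \<open>Subdirect subuniverses of a product of three algebras.\<close>

definition subdirect3 :: "('f \<Rightarrow> nat) \<Rightarrow> ('f, 'a) alg \<Rightarrow> ('f, 'b) alg \<Rightarrow> ('f, 'c) alg \<Rightarrow>
    ('a \<times> 'b \<times> 'c) set \<Rightarrow> bool" where
  "subdirect3 ar A B C R \<longleftrightarrow>
     subuniverse ar (A \<otimes> B \<otimes> C) R \<and>
     (\<lambda>(a, b, c). a) ` R = univ A \<and>
     (\<lambda>(a, b, c). b) ` R = univ B \<and>
     (\<lambda>(a, b, c). c) ` R = univ C"

text \<open>Every member of \<open>HS(A\<^sup>2)\<close> is isomorphic to a quotient of a subalgebra of \<open>A\<^sup>2\<close>, whose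
  elements are sets of pairs; so algebras over the following type represent all of \<open>HS(A\<^sup>2)\<close>.\<close>

type_synonym ('f, 'a) sq_quot = "('f, ('a \<times> 'a) set) alg"

end

theory Submission
  imports Defs "HOL-Library.FuncSet"
begin

text \<open>Write \<open>S = \<rho>\<^sup>*\<close>. A bridge \<open>T\<close> with trace \<open>1\<close>, read as a relation on the algebra \<open>S \<le> A\<^sup>2\<close>, gives a
  congruence \<open>\<Theta>\<close> of \<open>S\<close> that has \<open>\<rho>\<close> as one of its classes; choose \<open>\<Theta>\<close> maximal with this property. Then
  \<open>Z = S/\<Theta>\<close> with the point \<open>0 = \<rho>\<close> is simple, because the class of \<open>\<rho>\<close> under a larger congruence is
  \<open>\<rho>\<close>-saturated and \<open>S\<close> is minimal; the graph of \<open>S \<rightarrow> Z\<close> serves as \<open>\<zeta>\<close>.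

  That \<open>\<rho>\<close> is a \<open>\<Theta>\<close>-class means that changes along \<open>S\<close> are central modulo \<open>\<rho>\<close>: whether they
  affect the value of a term does not depend on the other arguments. Together with the Taylor
  identities this yields an idempotent ternary term \<open>p\<close> with \<open>p(a,b,b) \<rho> a \<rho> p(b,b,a)\<close> for
  \<open>(a,b) \<in> S\<close>. Indeed, if there is none, then in the finite monoid of binary idempotent terms
  one finds an idempotent \<open>f\<close> and some \<open>r = r f\<close> for which no Maltsev operation exists even after
  applying \<open>r\<close>, such that every factor \<open>m\<close> for which \<open>r m f\<close> still fails is invertible on the image
  of \<open>f\<close>. Some coordinate \<open>i\<close> of the Taylor term fails in this sense. Either a second coordinate fails,
  or both blocks of the identity for \<open>i\<close> do; in each case two complementary arguments can be
  inverted, and inverting them produces the missing operation.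

  Finally, \<open>x + y = p(x,0,y)\<close> satisfies \<open>[a,b] + [b,c] = [a,c]\<close> in \<open>Z\<close>, and any two elements can be
  written as \<open>[a,b]\<close>, \<open>[b,c]\<close>. Hence \<open>Z\<close> is a group for which all terms are additive, so \<open>Z\<close> is abelian and
  \<open>p\<close> is a Maltsev term of \<open>Z\<close>.\<close>

section \<open>Finite monoids of maps\<close>

text \<open>By pigeonhole the powers are eventually periodic: \<open>w ^^ i = w ^^ (i + p)\<close>
  with \<open>i, p > 0\<close>. The exponent \<open>i * p\<close> is at least \<open>i\<close> and a
  multiple of the period, so doubling it changes nothing.\<close>

lemma ex_idempotent_power:
  fixes w :: "'b \<Rightarrow> 'b"
  assumes fin: "finite M" and closed: "\<And>x y. x \<in> M \<Longrightarrow> y \<in> M \<Longrightarrow> x \<circ> y \<in> M" and w: "w \<in> M"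
  shows "\<exists>k. w ^^ Suc k \<in> M \<and> (w ^^ Suc k) \<circ> (w ^^ Suc k) = w ^^ Suc k"
proof -
  have inM: "w ^^ Suc k \<in> M" for k
    by (induction k) (use w closed in \<open>auto simp: comp_def\<close>)
  have "\<not> inj (\<lambda>k. w ^^ Suc k)"
  proof
    assume "inj (\<lambda>k. w ^^ Suc k)"
    moreover have "finite (range (\<lambda>k. w ^^ Suc k))"
      by (rule finite_subset[OF _ fin]) (use inM in blast)
    ultimately show False
      using finite_imageD infinite_UNIV_nat by blast
  qed
  then obtain i' j' where "w ^^ Suc i' = w ^^ Suc j'" "i' < j'"
    unfolding inj_def by (metis linorder_neqE_nat)
  then obtain i p where ip: "w ^^ i = w ^^ (i + p)" "i > 0" "p > 0"
    by (metis add_Suc less_imp_add_positive zero_less_Suc)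
  have step: "w ^^ m = w ^^ (m + c * p)" if "m \<ge> i" for m c
  proof (induction c)
    case (Suc c)
    have "w ^^ m = w ^^ ((m - i) + i)" using that by simp
    also have "\<dots> = w ^^ (m - i) \<circ> w ^^ (i + p)" unfolding funpow_add using ip(1) by (simp add: funpow_add)
    also have "\<dots> = w ^^ (m + p)" using that by (simp flip: funpow_add)
    finally have 1: "w ^^ m = w ^^ (m + p)" .
    have "m + Suc c * p = (m + p) + c * p" by simp
    then have "w ^^ (m + Suc c * p) = w ^^ (m + p) \<circ> w ^^ (c * p)"
      by (simp only: funpow_add)
    also have "\<dots> = w ^^ (m + c * p)" using 1 by (simp only: funpow_add)
    finally show ?case using Suc by simp
  qed simp
  obtain k where k: "i * p = Suc k" using ip by (cases "i * p") auto
  have "w ^^ Suc k = w ^^ (Suc k + Suc k)"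
  proof -
    have "i \<le> i * p" using ip by simp
    then show ?thesis using step[of "i * p" i] k by (simp only:)
  qed
  then have "(w ^^ Suc k) \<circ> (w ^^ Suc k) = w ^^ Suc k" by (metis funpow_add)
  then show ?thesis using inM by blast
qed

text \<open>Among the idempotents \<open>f\<close> admitting some \<open>r = r \<circ> f\<close>
  with \<open>P r\<close>, take one with smallest right ideal \<open>I f\<close>, then such an
  \<open>r\<close> with smallest \<open>I r\<close>. If \<open>P (r \<circ> m \<circ> f)\<close>,
  this composite competes with \<open>r\<close>, so
  \<open>r = r \<circ> m \<circ> f \<circ> n\<close> for some \<open>n\<close>; the idempotent power
  of \<open>f \<circ> m \<circ> f \<circ> n\<close> then competes with \<open>f\<close>, which makes
  \<open>f\<close> a right multiple of it.\<close>

lemma ex_minimal_idempotent: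
  fixes M :: "('b \<Rightarrow> 'b) set"
  assumes fin: "finite M" and id: "id \<in> M" and closed: "\<And>x y. x \<in> M \<Longrightarrow> y \<in> M \<Longrightarrow> x \<circ> y \<in> M"
    and P: "P id"
  obtains f r where "f \<in> M" "r \<in> M" "r \<circ> f = r" "P r"
    "\<And>m. m \<in> M \<Longrightarrow> P (r \<circ> m \<circ> f) \<Longrightarrow> \<exists>n\<in>M. f \<circ> m \<circ> f \<circ> n = f"
proof -
  define I where "I x = (\<lambda>m. x \<circ> m) ` M" for x :: "'b \<Rightarrow> 'b"
  have finI: "finite (I x)" for x using fin by (simp add: I_def)
  have inI: "x \<in> I x" for x unfolding I_def using id by (metis comp_id imageI)
  have I_mono: "I (x \<circ> y) \<subseteq> I x" if "y \<in> M" for x y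
    unfolding I_def using that closed by (auto simp: comp_assoc)
  define E where "E r f \<longleftrightarrow> r \<in> M \<and> f \<in> M \<and> f \<circ> f = f \<and> r \<circ> f = r \<and> P r" for r f
  have "\<exists>r. E r id" using id P by (auto simp: E_def)
  then obtain f where f: "\<exists>r. E r f" "\<And>f' r. E r f' \<Longrightarrow> card (I f) \<le> card (I f')"
    using ex_has_least_nat[of "\<lambda>f. \<exists>r. E r f" id "\<lambda>f. card (I f)"] by blast
  then obtain r where r: "E r f" "\<And>r'. E r' f \<Longrightarrow> card (I r) \<le> card (I r')"
    using ex_has_least_nat[of "\<lambda>r. E r f" _ "\<lambda>r. card (I r)"] by blast
  have rf: "r \<in> M" "f \<in> M" "f \<circ> f = f" "r \<circ> f = r" "P r" using r(1) by (auto simp: E_def)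
  have "\<exists>n\<in>M. f \<circ> m \<circ> f \<circ> n = f" if m: "m \<in> M" and Pm: "P (r \<circ> m \<circ> f)" for m
  proof -
    have "E (r \<circ> m \<circ> f) f" using rf m Pm closed by (auto simp: E_def comp_assoc)
    then have "card (I r) \<le> card (I (r \<circ> m \<circ> f))" by (rule r(2))
    moreover have "I (r \<circ> m \<circ> f) \<subseteq> I r"
      using I_mono[of "m \<circ> f" r] m rf closed by (simp add: comp_assoc)
    ultimately have "I (r \<circ> m \<circ> f) = I r" by (simp add: card_seteq finI)
    then obtain n where n: "n \<in> M" "r = r \<circ> m \<circ> f \<circ> n"
      using inI[of r] unfolding I_def by blast
    \<comment> \<open>\<open>w\<close> is absorbed by \<open>r\<close> and starts with
      \<open>f\<close>, so its idempotent power is again a candidate and has its right ideal inside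
      \<open>I f\<close>.\<close>
    define w where "w = f \<circ> m \<circ> f \<circ> n"
    have w: "w \<in> M" unfolding w_def using rf m n closed by auto
    have rw: "r \<circ> w = r" unfolding w_def using n(2) rf(4) by (metis comp_assoc)
    obtain k where k: "w ^^ Suc k \<in> M" "(w ^^ Suc k) \<circ> (w ^^ Suc k) = w ^^ Suc k"
      using ex_idempotent_power[OF fin closed w] by blast
    have wM: "w ^^ k \<in> M" by (induction k) (use id w closed in \<open>auto simp: id_def comp_def\<close>)
    have "r (w x) = r x" for x using rw by (metis comp_apply)
    then have "r \<circ> w ^^ l = r" for l by (induction l) (simp_all add: fun_eq_iff)
    then have "E r (w ^^ Suc k)" using k rf unfolding E_def by blast
    then have "card (I f) \<le> card (I (w ^^ Suc k))" by (rule f(2))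
    moreover have weq: "w ^^ Suc k = f \<circ> (m \<circ> f \<circ> n \<circ> w ^^ k)"
      unfolding w_def by (simp add: comp_assoc)
    moreover have "m \<circ> f \<circ> n \<circ> w ^^ k \<in> M" using m n rf wM closed by auto
    ultimately have "I (w ^^ Suc k) = I f"
      using I_mono by (metis card_seteq finI)
    then obtain x where x: "x \<in> M" "f = w ^^ Suc k \<circ> x"
      using inI[of f] unfolding I_def by blast
    have "f \<circ> m \<circ> f \<circ> (n \<circ> w ^^ k \<circ> x) = f \<circ> (m \<circ> f \<circ> n \<circ> w ^^ k) \<circ> x" by (simp only: comp_assoc)
    also have "\<dots> = f" using x(2) by (simp only: weq)
    finally have "f \<circ> m \<circ> f \<circ> (n \<circ> w ^^ k \<circ> x) = f" .
    moreover have "n \<circ> w ^^ k \<circ> x \<in> M" using n wM x closed by auto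
    ultimately show ?thesis by blast
  qed
  with that rf show thesis by blast
qed

section \<open>Taylor operations\<close>

text \<open>The ternary part of the clone generated by \<open>T\<close>. The arguments of
  \<open>T\<close> form a sequence, so that a block of coordinates is just a set of numbers.\<close>

inductive_set ternary_clone :: "((nat \<Rightarrow> 'a) \<Rightarrow> 'a) \<Rightarrow> ('a \<Rightarrow> 'a \<Rightarrow> 'a \<Rightarrow> 'a) set" for T where
  proj1: "(\<lambda>x y z. x) \<in> ternary_clone T"
| proj2: "(\<lambda>x y z. y) \<in> ternary_clone T"
| proj3: "(\<lambda>x y z. z) \<in> ternary_clone T"
| comp: "(\<And>j. G j \<in> ternary_clone T) \<Longrightarrow> (\<lambda>x y z. T (\<lambda>j. G j x y z)) \<in> ternary_clone T"

lemma ternary_clone_comp3: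
  assumes "g \<in> ternary_clone T" "h1 \<in> ternary_clone T" "h2 \<in> ternary_clone T" "h3 \<in> ternary_clone T"
  shows "(\<lambda>x y z. g (h1 x y z) (h2 x y z) (h3 x y z)) \<in> ternary_clone T"
  using assms
proof (induction rule: ternary_clone.induct)
  case (comp G)
  then show ?case
    using ternary_clone.comp[of "\<lambda>j x y z. G j (h1 x y z) (h2 x y z) (h3 x y z)" T] by simp
qed auto

text \<open>\<open>\<Theta>\<close> is viewed as a set of 2 by 2 matrices preserved by
  \<open>T\<close>; \<open>Theta_diag\<close> and \<open>Theta_rho\<close> express centrality modulo
  \<open>\<rho>\<close>. \<open>U\<close> and \<open>V\<close> are the positions of \<open>x\<close>
  on the two sides of the Taylor identity for \<open>i\<close>.\<close>

locale centralized_taylor =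
  fixes A :: "'a set" and n :: nat and T :: "(nat \<Rightarrow> 'a) \<Rightarrow> 'a"
    and S \<rho> :: "('a \<times> 'a) set" and \<Theta> :: "(('a \<times> 'a) \<times> ('a \<times> 'a)) set"
  assumes finite_A: "finite A"
    and n_pos: "0 < n"
    and T_idem: "x \<in> A \<Longrightarrow> T (\<lambda>_. x) = x"
    and T_Theta: "(\<And>j. j < n \<Longrightarrow> ((u j, u' j), (v j, v' j)) \<in> \<Theta>) \<Longrightarrow> ((T u, T u'), (T v, T v')) \<in> \<Theta>"
    and T_taylor: "i < n \<Longrightarrow> \<exists>U V. i \<in> U \<and> i \<notin> V \<and>
      (\<forall>x\<in>A. \<forall>y\<in>A. T (\<lambda>j. if j \<in> U then x else y) = T (\<lambda>j. if j \<in> V then x else y))"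
    and S_sub: "S \<subseteq> A \<times> A"
    and S_sym: "(a, b) \<in> S \<Longrightarrow> (b, a) \<in> S"
    and rho_equiv: "equiv A \<rho>"
    and Theta_sub: "\<Theta> \<subseteq> S \<times> S"
    and Theta_refl: "s \<in> S \<Longrightarrow> (s, s) \<in> \<Theta>"
    and Theta_diag: "a \<in> A \<Longrightarrow> b \<in> A \<Longrightarrow> ((a, a), (b, b)) \<in> \<Theta>"
    and Theta_rho: "(s, s') \<in> \<Theta> \<Longrightarrow> s \<in> \<rho> \<longleftrightarrow> s' \<in> \<rho>"
begin

abbreviation C where "C \<equiv> ternary_clone T"

lemmas proj1 = ternary_clone.proj1[of T] and proj2 = ternary_clone.proj2[of T] and proj3 = ternary_clone.proj3[of T]

section \<open>Relations preserved by the clone\<close>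

lemma S_refl: "a \<in> A \<Longrightarrow> (a, a) \<in> S"
  using Theta_diag Theta_sub by blast

lemma rho_refl: "a \<in> A \<Longrightarrow> (a, a) \<in> \<rho>"
  using rho_equiv by (simp add: equiv_def refl_on_def)

text \<open>Diagonal pairs are \<open>\<Theta>\<close>-related, so \<open>(T u, T u)\<close> lands
  in \<open>S\<close>.\<close>

lemma T_A:
  assumes "\<And>j. j < n \<Longrightarrow> u j \<in> A" shows "T u \<in> A"
  using T_Theta[of u u u u] assms Theta_diag Theta_sub S_sub by blast

lemma C_Theta:
  assumes "g \<in> C" "((a, a'), (d, d')) \<in> \<Theta>" "((b, b'), (e, e')) \<in> \<Theta>" "((c, c'), (h, h')) \<in> \<Theta>"
  shows "((g a b c, g a' b' c'), (g d e h, g d' e' h')) \<in> \<Theta>"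
  using assms by (induction rule: ternary_clone.induct) (auto intro!: T_Theta)

lemma C_S:
  assumes "g \<in> C" "(a, a') \<in> S" "(b, b') \<in> S" "(c, c') \<in> S"
  shows "(g a b c, g a' b' c') \<in> S"
  using C_Theta[OF assms(1), of a a' a a' b b' b b' c c' c c'] assms Theta_refl Theta_sub by blast

lemma C_A: "g \<in> C \<Longrightarrow> a \<in> A \<Longrightarrow> b \<in> A \<Longrightarrow> c \<in> A \<Longrightarrow> g a b c \<in> A"
  using C_S[of g a a b b c c] S_refl S_sub by blast

lemma C_idem:
  assumes "g \<in> C" "a \<in> A" shows "g a a a = a"
  using assms by (induction rule: ternary_clone.induct) (auto simp: T_idem)

section \<open>The finite monoid of binary members of the clone\<close>

text \<open>Binary members of the clone, as maps fixing the base point in the second component; they are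
  the identity outside \<open>A \<times> A\<close>, so that they form a finite monoid under \<open>(\<circ>)\<close>.\<close>

definition M :: "('a \<times> 'a \<Rightarrow> 'a \<times> 'a) set" where
  "M = {r. (\<forall>z. z \<notin> A \<times> A \<longrightarrow> r z = z) \<and> (\<exists>q\<in>C. \<forall>x\<in>A. \<forall>y\<in>A. r (x, y) = (q x y y, y))}"

definition lift :: "('a \<Rightarrow> 'a \<Rightarrow> 'a \<Rightarrow> 'a) \<Rightarrow> 'a \<times> 'a \<Rightarrow> 'a \<times> 'a" where
  "lift q z = (if z \<in> A \<times> A then (q (fst z) (snd z) (snd z), snd z) else z)"

lemma lift_M: "q \<in> C \<Longrightarrow> lift q \<in> M"
  by (auto simp: M_def lift_def)

lemma lift_app: "x \<in> A \<Longrightarrow> y \<in> A \<Longrightarrow> lift q (x, y) = (q x y y, y)"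
  by (simp add: lift_def)

lemma M_E:
  assumes "r \<in> M" obtains q where "q \<in> C" "r = lift q"
proof -
  obtain q where q: "\<forall>z. z \<notin> A \<times> A \<longrightarrow> r z = z" "q \<in> C" "\<forall>x\<in>A. \<forall>y\<in>A. r (x, y) = (q x y y, y)"
    using assms by (auto simp: M_def)
  then have "r = lift q" by (auto simp: lift_def fun_eq_iff)
  with q that show thesis by blast
qed

lemma M_id: "id \<in> M"
proof -
  have "lift (\<lambda>x y z. x) = id" by (auto simp: lift_def fun_eq_iff)
  then show ?thesis using lift_M[OF ternary_clone.proj1] by simp
qed

lemma M_comp:
  assumes "r \<in> M" "s \<in> M" shows "r \<circ> s \<in> M"
proof -
  obtain q q' where q: "q \<in> C" "r = lift q" "q' \<in> C" "s = lift q'" by (metis M_E assms)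
  have "r \<circ> s = lift (\<lambda>x y z. q (q' x y y) y y)"
    using q C_A by (auto simp: lift_def fun_eq_iff)
  moreover have "(\<lambda>x y z. q (q' x y y) y y) \<in> C"
    using ternary_clone_comp3[OF q(1) ternary_clone_comp3[OF q(3) proj1 proj2 proj2] proj2 proj2] .
  ultimately show ?thesis using lift_M by simp
qed

lemma M_finite: "finite M"
proof -
  let ?B = "A \<times> A"
  have inj: "inj_on (\<lambda>r. restrict r ?B) M"
  proof (rule inj_onI)
    fix r s assume "r \<in> M" "s \<in> M" and eq: "restrict r ?B = restrict s ?B"
    then have out: "r z = s z" if "z \<notin> ?B" for z using that by (auto elim!: M_E simp: lift_def)
    show "r = s"
    proof
      fix z show "r z = s z" using out fun_cong[OF eq, of z] by (cases "z \<in> ?B") auto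
    qed
  qed
  have "(\<lambda>r. restrict r ?B) ` M \<subseteq> ?B \<rightarrow>\<^sub>E ?B"
  proof (rule image_subsetI)
    fix r assume "r \<in> M"
    then show "restrict r ?B \<in> ?B \<rightarrow>\<^sub>E ?B"
      by (auto simp: restrict_PiE_iff lift_app C_A elim!: M_E)
  qed
  then have "finite ((\<lambda>r. restrict r ?B) ` M)"
    by (rule finite_subset) (simp add: finite_PiE finite_A)
  then show ?thesis using inj by (rule finite_imageD)
qed

section \<open>Maltsev operations along \<open>S\<close>, assembled from blocks of arguments\<close>

text \<open>\<open>r\<close> is good if the Maltsev identities along \<open>S\<close> hold modulo \<open>\<rho>\<close> once \<open>r\<close> has been applied; the
  aim is to see that \<open>id\<close> is good.\<close>

definition good :: "('a \<times> 'a \<Rightarrow> 'a \<times> 'a) \<Rightarrow> bool" where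
  "good r \<longleftrightarrow> (\<exists>g\<in>C. \<forall>(a, b)\<in>S.
     (fst (r (g a b b, b)), fst (r (a, b))) \<in> \<rho> \<and> (fst (r (g b b a, b)), fst (r (a, b))) \<in> \<rho>)"

text \<open>At \<open>(x, y, y)\<close> this is the binary operation with \<open>x\<close> exactly
  on \<open>K\<close>, and at \<open>(y, y, x)\<close> the one with \<open>x\<close> exactly outside
  \<open>K\<close>: the two patterns of the Maltsev identities.\<close>

definition block :: "nat set \<Rightarrow> 'a \<Rightarrow> 'a \<Rightarrow> 'a \<Rightarrow> 'a" where
  "block K x y z = T (\<lambda>j. if j \<in> K then x else z)"

lemma block_C: "block K \<in> C"
proof -
  define H :: "nat \<Rightarrow> 'a \<Rightarrow> 'a \<Rightarrow> 'a \<Rightarrow> 'a"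
    where "H j = (if j \<in> K then (\<lambda>x y z. x) else (\<lambda>x y z. z))" for j
  have "H j \<in> C" for j by (simp add: H_def proj1 proj3)
  then have "(\<lambda>x y z. T (\<lambda>j. H j x y z)) \<in> C" by (rule ternary_clone.comp)
  also have "(\<lambda>x y z. T (\<lambda>j. H j x y z)) = block K"
    unfolding block_def H_def by (intro ext arg_cong[where f = T]) auto
  finally show ?thesis .
qed

text \<open>Here centrality enters: whether a change of the arguments in \<open>K\<close> along \<open>S\<close> matters modulo
  \<open>\<rho>\<close> does not depend on the arguments outside \<open>K\<close>.\<close>

lemma change_block:
  assumes q: "q \<in> C" and b: "b \<in> A"
    and u: "\<And>k. k < n \<Longrightarrow> u k \<in> A"
    and uv: "\<And>k. k < n \<Longrightarrow> k \<in> K \<Longrightarrow> (u k, v k) \<in> S"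
    and off: "\<And>k. k < n \<Longrightarrow> k \<notin> K \<Longrightarrow> u k = v k"
    and rel: "(q (T (\<lambda>k. if k \<in> K then u k else b)) b b, q (T (\<lambda>k. if k \<in> K then v k else b)) b b) \<in> \<rho>"
  shows "(q (T u) b b, q (T v) b b) \<in> \<rho>"
proof -
  let ?w = "\<lambda>u k. if k \<in> K then u k else b"
  \<comment> \<open>On \<open>K\<close> both rows are the same pair of \<open>S\<close>; off
    \<open>K\<close> they are the diagonal pairs \<open>(b, b)\<close> and
    \<open>(u k, u k)\<close>.\<close>
  have "((T (?w u), T (?w v)), (T u, T v)) \<in> \<Theta>"
  proof (rule T_Theta)
    fix k assume k: "k < n"
    show "((?w u k, ?w v k), (u k, v k)) \<in> \<Theta>"
      using Theta_refl[OF uv[OF k]] off[OF k] Theta_diag[OF b u[OF k]] by (cases "k \<in> K") simp_all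
  qed
  then have "((q (T (?w u)) b b, q (T (?w v)) b b), (q (T u) b b, q (T v) b b)) \<in> \<Theta>"
    by (rule C_Theta[OF q _ Theta_diag[OF b b] Theta_diag[OF b b]])
  then show ?thesis using rel Theta_rho by blast
qed

text \<open>Walk from \<open>u\<close> to \<open>v\<close>: first all positions of \<open>K\<close>
  at once, then the others one at a time, each stage being an instance of
  \<open>change_block\<close>. In \<open>?w m\<close> the positions of \<open>K\<close> and those
  below \<open>m\<close> have been changed.\<close>

lemma change_all:
  assumes q: "q \<in> C" and b: "b \<in> A"
    and uv: "\<And>k. k < n \<Longrightarrow> (u k, v k) \<in> S"
    and blk: "(q (T (\<lambda>k. if k \<in> K then u k else b)) b b, q (T (\<lambda>k. if k \<in> K then v k else b)) b b) \<in> \<rho>"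
    and single: "\<And>j. j < n \<Longrightarrow> j \<notin> K \<Longrightarrow>
      (q (T (\<lambda>k. if k \<in> {j} then u k else b)) b b, q (T (\<lambda>k. if k \<in> {j} then v k else b)) b b) \<in> \<rho>"
  shows "(q (T u) b b, q (T v) b b) \<in> \<rho>"
proof -
  have uA: "u k \<in> A" and vA: "v k \<in> A" if "k < n" for k using uv[OF that] S_sub by auto
  let ?w = "\<lambda>m k. if k \<in> K \<or> k < m then v k else u k"
  have "(q (T u) b b, q (T (?w m)) b b) \<in> \<rho>" if "m \<le> n" for m
    using that
  proof (induction m)
    case 0
    show ?case
      by (rule change_block[OF q b, where K = K])
        (use uA uv blk in \<open>auto cong: if_cong\<close>)
  next
    case (Suc m)
    have "(q (T (?w m)) b b, q (T (?w (Suc m))) b b) \<in> \<rho>"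
    proof (cases "m \<in> K")
      case True
      then have "?w (Suc m) = ?w m" by (auto simp: fun_eq_iff less_Suc_eq)
      moreover have "q (T (?w m)) b b \<in> A"
        by (intro C_A[OF q] T_A b) (use uA vA in auto)
      ultimately show ?thesis using rho_refl by simp
    next
      case False
      have eq: "(\<lambda>k. if k \<in> {m} then ?w m k else b) = (\<lambda>k. if k \<in> {m} then u k else b)"
        "(\<lambda>k. if k \<in> {m} then ?w (Suc m) k else b) = (\<lambda>k. if k \<in> {m} then v k else b)"
        using False by auto
      show ?thesis
        by (rule change_block[OF q b, where K = "{m}"])
          (use uA vA uv Suc.prems single[of m] False eq in auto)
    qed
    then show ?case using Suc rho_equiv by (meson Suc_leD equiv_def transD)
  qed
  from this[of n] have 1: "(q (T u) b b, q (T (?w n)) b b) \<in> \<rho>" by simp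
  \<comment> \<open>\<open>?w n\<close> and \<open>v\<close> agree below \<open>n\<close> but may
    differ as sequences; \<open>T_Theta\<close> looks only below \<open>n\<close> and gives equality
    modulo \<open>\<rho>\<close>.\<close>
  have "((T (?w n), T v), (T (?w n), T (?w n))) \<in> \<Theta>" 
    by (rule T_Theta) (use vA Theta_diag in auto)
  then have "((q (T (?w n)) b b, q (T v) b b), (q (T (?w n)) b b, q (T (?w n)) b b)) \<in> \<Theta>"
    by (rule C_Theta[OF q _ Theta_diag[OF b b] Theta_diag[OF b b]])
  moreover have "q (T (?w n)) b b \<in> A"
    by (intro C_A[OF q] T_A b) (use vA in auto)
  ultimately have "(q (T (?w n)) b b, q (T v) b b) \<in> \<rho>" using Theta_rho rho_refl by blast
  with 1 show ?thesis using rho_equiv by (meson equiv_def transD)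
qed

text \<open>\<open>g\<close> applies \<open>T\<close> to separately corrected arguments: one common
  \<open>g0\<close> for the positions in \<open>K\<close>, whose joint change is controlled by
  \<open>blk\<close>, and an own \<open>g1 j\<close> for each other position. Then
  \<open>change_all\<close> replaces every argument by \<open>e a b b\<close>, and idempotence with
  \<open>r \<circ> f = r\<close> gives \<open>q a b b\<close>.\<close>

lemma good_assemble:
  assumes r: "r \<in> M" and f: "f \<in> M" and rf: "r \<circ> f = r"
    and blk: "good (r \<circ> lift (block K) \<circ> f)"
    and single: "\<And>j. j < n \<Longrightarrow> j \<notin> K \<Longrightarrow> good (r \<circ> lift (block {j}) \<circ> f)"
  shows "good r"
proof -
  obtain q where q: "q \<in> C" "r = lift q" using r M_E by blast
  obtain e where e: "e \<in> C" "f = lift e" using f M_E by blast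
  \<comment> \<open>Goodness of \<open>r \<circ> lift (block L) \<circ> f\<close> in coordinates,
    with \<open>q\<close> and \<open>e\<close> for \<open>r\<close> and \<open>f\<close>.\<close>
  define ok where "ok L g \<longleftrightarrow> g \<in> C \<and> (\<forall>(a, b)\<in>S.
     (q (block L (e (g a b b) b b) b b) b b, q (block L (e a b b) b b) b b) \<in> \<rho> \<and>
     (q (block L (e (g b b a) b b) b b) b b, q (block L (e a b b) b b) b b) \<in> \<rho>)" for L g
  have good_ok: "\<exists>g. ok L g" if good: "good (r \<circ> lift (block L) \<circ> f)" for L
  proof -
    obtain g where g: "g \<in> C" and g': "\<forall>(a, b)\<in>S.
       (fst ((r \<circ> lift (block L) \<circ> f) (g a b b, b)), fst ((r \<circ> lift (block L) \<circ> f) (a, b))) \<in> \<rho> \<and>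
       (fst ((r \<circ> lift (block L) \<circ> f) (g b b a, b)), fst ((r \<circ> lift (block L) \<circ> f) (a, b))) \<in> \<rho>"
      using good unfolding good_def by blast
    have "fst ((r \<circ> lift (block L) \<circ> f) (x, b)) = q (block L (e x b b) b b) b b" if "x \<in> A" "b \<in> A" for x b
      using that q e by (simp add: lift_app C_A block_C)
    moreover have "a \<in> A" "b \<in> A" "g a b b \<in> A" "g b b a \<in> A" if "(a, b) \<in> S" for a b
      using that S_sub C_A[OF g] by auto
    ultimately have "ok L g" unfolding ok_def using g g' by fastforce
    then show ?thesis by blast
  qed
  obtain g0 where g0: "ok K g0" using good_ok[OF blk] by blast
  obtain g1 where g1: "\<And>j. j < n \<Longrightarrow> j \<notin> K \<Longrightarrow> ok {j} (g1 j)"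
    using good_ok[OF single] by metis
  \<comment> \<open>The composition rule wants a member of the clone at every index, so
    \<open>g0\<close> also serves from \<open>n\<close> on.\<close>
  define G where "G k = (if k \<in> K then g0 else if k < n then g1 k else g0)" for k
  have GC: "G k \<in> C" for k using g0 g1 by (auto simp: G_def ok_def)
  define g where "g x y z = T (\<lambda>k. e (G k x y z) y y)" for x y z
  have gC: "g \<in> C"
    unfolding g_def by (rule ternary_clone.comp) (rule ternary_clone_comp3[OF e(1) GC proj2 proj2])
  \<comment> \<open>Covers both Maltsev identities: \<open>x k\<close> stands for
    \<open>G k a b b\<close> or \<open>G k b b a\<close>, which are \<open>S\<close>-related to
    \<open>a = G k a a a\<close>.\<close>
  have main: "(q (T (\<lambda>k. e (x k) b b)) b b, q a b b) \<in> \<rho>"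
    if ab: "(a, b) \<in> S" and x: "\<And>k. (x k, a) \<in> S" 
      and xK: "(q (T (\<lambda>k. if k \<in> K then e (x k) b b else b)) b b, q (block K (e a b b) b b) b b) \<in> \<rho>"
      and xj: "\<And>j. j < n \<Longrightarrow> j \<notin> K \<Longrightarrow> (q (block {j} (e (x j) b b) b b) b b, q (block {j} (e a b b) b b) b b) \<in> \<rho>"
    for a b x
  proof -
    have A: "a \<in> A" "b \<in> A" using ab S_sub by auto
    have "(q (T (\<lambda>k. e (x k) b b)) b b, q (T (\<lambda>k. e a b b)) b b) \<in> \<rho>"
    proof (rule change_all[OF q(1), where K = K])
      show "(e (x k) b b, e a b b) \<in> S" for k
        using C_S[OF e(1) x] S_refl A by blast
      show "(q (T (\<lambda>k. if k \<in> {j} then e (x k) b b else b)) b b, q (T (\<lambda>k. if k \<in> {j} then e a b b else b)) b b) \<in> \<rho>"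
        if "j < n" "j \<notin> K" for j
      proof -
        have "(\<lambda>k. if k \<in> {j} then e (x k) b b else b) = (\<lambda>k. if k \<in> {j} then e (x j) b b else b)" by auto
        then show ?thesis using xj[OF that] unfolding block_def by simp
      qed
    qed (use xK A in \<open>auto simp: block_def\<close>)
    moreover have "q (T (\<lambda>k. e a b b)) b b = q a b b"
    proof -
      have "lift q (lift e (a, b)) = lift q (a, b)" using rf q e by (metis comp_apply)
      then show ?thesis using A e q by (simp add: lift_app C_A T_idem)
    qed
    ultimately show ?thesis by simp
  qed
  have xK: "T (\<lambda>k. if k \<in> K then e (G k x y z) b b else b) = block K (e (g0 x y z) b b) b b" for x y z b
    unfolding block_def by (intro arg_cong[where f = T]) (auto simp: G_def)
  have ok0: "(q (block K (e (g0 a b b) b b) b b) b b, q (block K (e a b b) b b) b b) \<in> \<rho>"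
    "(q (block K (e (g0 b b a) b b) b b) b b, q (block K (e a b b) b b) b b) \<in> \<rho>"
    if "(a, b) \<in> S" for a b using that g0 unfolding ok_def by auto
  have ok1: "(q (block {j} (e (G j a b b) b b) b b) b b, q (block {j} (e a b b) b b) b b) \<in> \<rho>"
    "(q (block {j} (e (G j b b a) b b) b b) b b, q (block {j} (e a b b) b b) b b) \<in> \<rho>"
    if "(a, b) \<in> S" "j < n" "j \<notin> K" for a b j
    using that g1[OF that(2,3)] unfolding ok_def G_def by auto
  have "(q (g a b b) b b, q a b b) \<in> \<rho> \<and> (q (g b b a) b b, q a b b) \<in> \<rho>" if ab: "(a, b) \<in> S" for a b
  proof
    have A: "a \<in> A" "b \<in> A" using ab S_sub by auto
    have ba: "(b, a) \<in> S" using ab S_sym by blast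
    show "(q (g a b b) b b, q a b b) \<in> \<rho>"
      unfolding g_def
    proof (rule main[OF ab])
      show "(G k a b b, a) \<in> S" for k
        using C_S[OF GC[of k] S_refl[OF A(1)] ba ba] C_idem[OF GC A(1)] by simp
    qed (use ok0[OF ab] ok1[OF ab] in \<open>auto simp only: xK\<close>)
    show "(q (g b b a) b b, q a b b) \<in> \<rho>"
      unfolding g_def
    proof (rule main[OF ab])
      show "(G k b b a, a) \<in> S" for k
        using C_S[OF GC[of k] ba ba S_refl[OF A(1)]] C_idem[OF GC A(1)] by simp
    qed (use ok0[OF ab] ok1[OF ab] in \<open>auto simp only: xK\<close>)
  qed
  moreover have "a \<in> A" "b \<in> A" "g a b b \<in> A" "g b b a \<in> A" if "(a, b) \<in> S" for a b
    using that S_sub C_A[OF gC] by auto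
  ultimately show ?thesis
    unfolding good_def using gC q by (intro bexI[of _ g]) (auto simp: lift_app)
qed

text \<open>Insert the right inverses \<open>c\<close> for \<open>\<alpha>\<close> and
  \<open>d\<close> for \<open>\<beta>\<close> into the outer arguments of \<open>h\<close>. At
  \<open>(a, b, b)\<close> the third argument collapses to \<open>b\<close> by idempotence, so
  \<open>h\<close> becomes \<open>\<alpha>\<close>, and under \<open>e\<close> the inverse
  \<open>c\<close> recovers \<open>e a b b\<close>; the other side is symmetric. As \<open>r\<close>
  factors through \<open>f\<close>, equality under \<open>e\<close> suffices.\<close>

lemma good_of_right_inverses:
  assumes r: "r \<in> M" and f: "f \<in> M" and rf: "r \<circ> f = r"
    and h: "h \<in> C" "\<alpha> \<in> C" "\<beta> \<in> C"
      "\<And>x y. x \<in> A \<Longrightarrow> y \<in> A \<Longrightarrow> h x y y = \<alpha> x y y"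
      "\<And>x y. x \<in> A \<Longrightarrow> y \<in> A \<Longrightarrow> h y y x = \<beta> x y y"
    and inv: "\<exists>m\<in>M. f \<circ> lift \<alpha> \<circ> f \<circ> m = f" "\<exists>m\<in>M. f \<circ> lift \<beta> \<circ> f \<circ> m = f"
  shows "good r"
proof -
  obtain q where q: "q \<in> C" "r = lift q" using r M_E by blast
  obtain e where e: "e \<in> C" "f = lift e" using f M_E by blast
  obtain c where c: "c \<in> C" "f \<circ> lift \<alpha> \<circ> f \<circ> lift c = f" using inv M_E by metis
  obtain d where d: "d \<in> C" "f \<circ> lift \<beta> \<circ> f \<circ> lift d = f" using inv M_E by metis
  define g where "g x y z = h (e (c x y y) y y) y (e (d z y y) y y)" for x y z
  have gC: "g \<in> C"
    unfolding g_def
    by (rule ternary_clone_comp3[OF h(1)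
          ternary_clone_comp3[OF e(1) ternary_clone_comp3[OF c(1) proj1 proj2 proj2] proj2 proj2] proj2
          ternary_clone_comp3[OF e(1) ternary_clone_comp3[OF d(1) proj3 proj2 proj2] proj2 proj2]])
  have eq: "e (g a b b) b b = e a b b" "e (g b b a) b b = e a b b" if A: "a \<in> A" "b \<in> A" for a b
  proof -
    have "(f \<circ> lift \<alpha> \<circ> f \<circ> lift c) (a, b) = f (a, b)" "(f \<circ> lift \<beta> \<circ> f \<circ> lift d) (a, b) = f (a, b)"
      by (simp_all only: c d)
    then have "e (\<alpha> (e (c a b b) b b) b b) b b = e a b b" "e (\<beta> (e (d a b b) b b) b b) b b = e a b b"
      using A e h c d by (simp_all add: lift_app C_A)
    then show "e (g a b b) b b = e a b b" "e (g b b a) b b = e a b b"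
      using A h e c d by (simp_all add: g_def C_A C_idem)
  qed
  have r_eq: "r (x, b) = r (x', b)" if "e x b b = e x' b b" "x \<in> A" "x' \<in> A" "b \<in> A" for x x' b
  proof -
    have "f (x, b) = f (x', b)" using that e by (simp add: lift_app)
    then show ?thesis using rf by (metis comp_apply)
  qed
  have "r (g a b b, b) = r (a, b)" "r (g b b a, b) = r (a, b)" if A: "a \<in> A" "b \<in> A" for a b
    using r_eq[OF eq(1)[OF A] C_A[OF gC A(1,2,2)] A] r_eq[OF eq(2)[OF A] C_A[OF gC A(2,2,1)] A] by auto
  moreover have "fst (r (a, b)) \<in> A" if "a \<in> A" "b \<in> A" for a b
    using that q by (simp add: lift_app C_A)
  ultimately show ?thesis
    unfolding good_def using gC S_sub rho_refl by (intro bexI[of _ g]) auto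
qed

lemma ex_maltsev_on_S:
  "\<exists>g\<in>C. \<forall>(a, b)\<in>S. (g a b b, a) \<in> \<rho> \<and> (g b b a, a) \<in> \<rho>"
proof (rule ccontr)
  assume "\<not> ?thesis"
  then have "\<not> good id" by (simp add: good_def)
  \<comment> \<open>\<open>r\<close> is bad, and a map that stays bad between \<open>r\<close> and
    \<open>f\<close> has a right inverse on the image of \<open>f\<close>.\<close>
  then obtain f r where f: "f \<in> M" and r: "r \<in> M" and rf: "r \<circ> f = r" and bad: "\<not> good r"
    and inv: "\<And>m. m \<in> M \<Longrightarrow> \<not> good (r \<circ> m \<circ> f) \<Longrightarrow> \<exists>k\<in>M. f \<circ> m \<circ> f \<circ> k = f"
    using ex_minimal_idempotent[OF M_finite M_id M_comp, where P = "\<lambda>r. \<not> good r"] by blast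
  note inv = inv[OF lift_M[OF block_C]]
  have contra: False if "h \<in> C" "\<not> good (r \<circ> lift (block K) \<circ> f)" "\<not> good (r \<circ> lift (block L) \<circ> f)"
      "\<And>x y. x \<in> A \<Longrightarrow> y \<in> A \<Longrightarrow> h x y y = block K x y y"
      "\<And>x y. x \<in> A \<Longrightarrow> y \<in> A \<Longrightarrow> h y y x = block L x y y" for h K L
    using good_of_right_inverses[OF r f rf that(1) block_C block_C that(4,5) inv[OF that(2)] inv[OF that(3)]] bad
    by blast
  \<comment> \<open>If every single position were good, \<open>good_assemble\<close> would make
    \<open>r\<close> good.\<close>
  obtain i where i: "i < n" "\<not> good (r \<circ> lift (block {i}) \<circ> f)"
    using good_assemble[OF r f rf, of "{0}"] n_pos bad by blast
  show False
  proof (cases "\<exists>j<n. j \<noteq> i \<and> \<not> good (r \<circ> lift (block {j}) \<circ> f)")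
    case True
    then obtain j where j: "j < n" "j \<noteq> i" "\<not> good (r \<circ> lift (block {j}) \<circ> f)" by blast
    \<comment> \<open>The outer arguments go to the two bad positions \<open>i\<close> and
      \<open>j\<close>, the middle one everywhere else.\<close>
    define h where "h x y z = T (\<lambda>k. if k = i then x else if k = j then z else y)" for x y z :: 'a
    have "h \<in> C"
    proof -
      define H :: "nat \<Rightarrow> 'a \<Rightarrow> 'a \<Rightarrow> 'a \<Rightarrow> 'a"
        where "H k = (if k = i then (\<lambda>x y z. x) else if k = j then (\<lambda>x y z. z) else (\<lambda>x y z. y))" for k
      have "H k \<in> C" for k by (simp add: H_def proj1 proj2 proj3)
      then have "(\<lambda>x y z. T (\<lambda>k. H k x y z)) \<in> C" by (rule ternary_clone.comp)
      also have "(\<lambda>x y z. T (\<lambda>k. H k x y z)) = h"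
        unfolding h_def H_def by (intro ext arg_cong[where f = T]) auto
      finally show ?thesis .
    qed
    then show False
      by (rule contra[OF _ i(2) j(3)])
        (use j in \<open>auto simp: h_def block_def intro!: arg_cong[where f = T]\<close>)
  next
    case False
    obtain U V where UV: "i \<in> U" "i \<notin> V"
      "\<And>x y. x \<in> A \<Longrightarrow> y \<in> A \<Longrightarrow> T (\<lambda>j. if j \<in> U then x else y) = T (\<lambda>j. if j \<in> V then x else y)"
      using T_taylor[OF i(1)] by blast
    \<comment> \<open>All positions below \<open>n\<close> other than \<open>i\<close> are good, and
      \<open>i\<close> lies in both \<open>U\<close> and \<open>- V\<close>; if either block were
      good, \<open>good_assemble\<close> would make \<open>r\<close> good.\<close>
    have 1: "\<not> good (r \<circ> lift (block U) \<circ> f)" 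
      using good_assemble[OF r f rf, of U] False UV bad by blast
    have 2: "\<not> good (r \<circ> lift (block (- V)) \<circ> f)"
      using good_assemble[OF r f rf, of "- V"] False UV bad by blast
    show False
    proof (rule contra[OF block_C 1 2])
      \<comment> \<open>At \<open>(y, y, x)\<close> the left side of the Taylor identity has
        \<open>y\<close> on \<open>U\<close>; its right side has \<open>y\<close> on
        \<open>V\<close>, that is, \<open>x\<close> exactly on \<open>- V\<close>.\<close>
      fix x y assume "x \<in> A" "y \<in> A"
      then show "block U y y x = block (- V) x y y"
        unfolding block_def by (subst UV(3)) (auto intro!: arg_cong[where f = T])
    qed simp
  qed
qed

end

section \<open>Terms and products\<close>

fun subst_trm :: "'f trm list \<Rightarrow> 'f trm \<Rightarrow> 'f trm" where
  "subst_trm ss (Var i) = ss ! i"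
| "subst_trm ss (App f ts) = App f (map (subst_trm ss) ts)"

lemma wf_subst_trm:
  "wf_trm ar (length ss) t \<Longrightarrow> \<forall>s\<in>set ss. wf_trm ar k s \<Longrightarrow> wf_trm ar k (subst_trm ss t)"
  by (induction t) auto

lemma term_op_subst_trm:
  "wf_trm ar (length ss) t \<Longrightarrow> term_op A (subst_trm ss t) xs = term_op A t (map (\<lambda>s. term_op A s xs) ss)"
  by (induction t) (auto intro!: arg_cong[where f = "interp A _"])

text \<open>Composition in the clone is substitution of terms; only the first \<open>n\<close>
  members of the sequence \<open>G\<close> enter.\<close>

lemma ternary_clone_term:
  assumes "wf_trm ar n t" and "g \<in> ternary_clone (\<lambda>u. term_op A t (map u [0..<n]))"
  shows "\<exists>s. wf_trm ar 3 s \<and> (\<forall>x y z. g x y z = term_op A s [x, y, z])"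
  using assms(2)
proof (induction rule: ternary_clone.induct)
  case proj1
  show ?case by (rule exI[of _ "Var 0"]) simp
next
  case proj2
  show ?case by (rule exI[of _ "Var 1"]) simp
next
  case proj3
  show ?case by (rule exI[of _ "Var 2"]) simp
next
  case (comp G)
  then obtain s where s: "\<And>j. wf_trm ar 3 (s j)" "\<And>j x y z. G j x y z = term_op A (s j) [x, y, z]"
    by metis
  let ?s = "subst_trm (map s [0..<n]) t"
  have "wf_trm ar 3 ?s" using assms(1) s(1) by (intro wf_subst_trm) auto
  moreover have "term_op A t (map (\<lambda>j. G j x y z) [0..<n]) = term_op A ?s [x, y, z]" for x y z
    using assms(1) s(2) by (subst term_op_subst_trm[where ar = ar]) (auto simp: comp_def)
  ultimately show ?case by blast
qed

lemma term_op_closed: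
  assumes "closed_under ar A B" "wf_trm ar n t" "length xs = n" "set xs \<subseteq> B"
  shows "term_op A t xs \<in> B"
  using assms(2)
proof (induction t)
  case (App f ts)
  then have "set (map (\<lambda>t. term_op A t xs) ts) \<subseteq> B" by auto
  then show ?case using App.prems assms(1) unfolding closed_under_def by simp
qed (use assms in \<open>auto simp: subset_code\<close>)

lemma univ_prod [simp]: "univ (A \<otimes> B) = univ A \<times> univ B"
  and interp_prod [simp]: "interp (A \<otimes> B) f xs = (interp A f (map fst xs), interp B f (map snd xs))"
  by (simp_all add: prod_alg_def)

lemma term_op_prod:
  "wf_trm ar (length xs) t \<Longrightarrow>
    term_op (A \<otimes> B) t xs = (term_op A t (map fst xs), term_op B t (map snd xs))"
proof (induction t)
  case (App f ts)
  then have eq: "map (\<lambda>t. term_op (A \<otimes> B) t xs) ts = map (\<lambda>t. (term_op A t (map fst xs), term_op B t (map snd xs))) ts"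
    by auto
  show ?case unfolding term_op.simps eq by (simp add: comp_def)
qed auto

lemma closed_underD:
  "closed_under ar A B \<Longrightarrow> length xs = ar f \<Longrightarrow> set xs \<subseteq> B \<Longrightarrow> interp A f xs \<in> B"
  by (simp add: closed_under_def)

section \<open>Quotients in which the class of \<open>\<rho>\<close> is a point\<close>

locale central_congruence =
  fixes ar :: "'f \<Rightarrow> nat" and A :: "('f, 'a) alg" and \<rho> S :: "('a \<times> 'a) set"
    and \<Theta> :: "(('a \<times> 'a) \<times> ('a \<times> 'a)) set"
  assumes algebra: "is_algebra ar A"
    and rho: "\<rho> \<in> Con ar A"
    and S: "subuniverse ar (A \<otimes> A) S"
    and S_sym: "(a, b) \<in> S \<Longrightarrow> (b, a) \<in> S"
    and rho_S: "\<rho> \<subset> S"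
    and equiv: "equiv S \<Theta>"
    and closed: "closed_under ar ((A \<otimes> A) \<otimes> (A \<otimes> A)) \<Theta>"
    and sat: "(a, b) \<in> S \<Longrightarrow> (a, c) \<in> \<rho> \<Longrightarrow> (b, d) \<in> \<rho> \<Longrightarrow> ((a, b), (c, d)) \<in> \<Theta>"
    and rho_rho: "s \<in> \<rho> \<Longrightarrow> s' \<in> \<rho> \<Longrightarrow> (s, s') \<in> \<Theta>"
    and rho_class: "(s, s') \<in> \<Theta> \<Longrightarrow> s \<in> \<rho> \<Longrightarrow> s' \<in> \<rho>"
begin

definition cls :: "'a \<times> 'a \<Rightarrow> ('a \<times> 'a) set" where
  "cls s = \<Theta> `` {s}"

text \<open>Operations are computed on chosen representatives, and \<open>interp_Z\<close> shows
  that the choice is immaterial. The zero of \<open>Z\<close> is the set \<open>\<rho>\<close>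
  itself, one of the classes.\<close>

definition Z :: "('f, 'a) sq_quot" where
  "Z = \<lparr>univ = S // \<Theta>, interp = \<lambda>f Xs. cls (interp (A \<otimes> A) f (map (\<lambda>X. SOME s. s \<in> X) Xs))\<rparr>"

lemma S_sub: "S \<subseteq> univ A \<times> univ A"
  and S_closed: "closed_under ar (A \<otimes> A) S"
  using S by (simp_all add: subuniverse_def)

lemma Theta_sub: "\<Theta> \<subseteq> S \<times> S"
  using equiv by (rule equiv_type)

lemma rho_equiv: "equiv (univ A) \<rho>"
  using rho by (simp add: Con_def)

lemma rho_refl: "a \<in> univ A \<Longrightarrow> (a, a) \<in> \<rho>"
  using rho_equiv by (simp add: equiv_def refl_on_def)

lemma rho_sym: "(a, b) \<in> \<rho> \<Longrightarrow> (b, a) \<in> \<rho>"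
  using rho_equiv by (meson equiv_def symE)

lemma S_refl: "a \<in> univ A \<Longrightarrow> (a, a) \<in> S"
  using rho_refl rho_S by blast

lemma cls_eqI: "(s, s') \<in> \<Theta> \<Longrightarrow> cls s = cls s'"
  unfolding cls_def using equiv by (rule equiv_class_eq)

lemma univ_Z: "univ Z = cls ` S"
  by (auto simp: Z_def cls_def quotient_def)

lemma cls_rho: "s \<in> \<rho> \<Longrightarrow> cls s = \<rho>"
  unfolding cls_def using rho_rho rho_class by blast

lemma cls_eq_rho: "s \<in> S \<Longrightarrow> cls s = \<rho> \<longleftrightarrow> s \<in> \<rho>"
  using cls_rho equiv_class_self[OF equiv] unfolding cls_def by blast

lemma cls_diag: "a \<in> univ A \<Longrightarrow> cls (a, a) = \<rho>"
  using cls_rho rho_refl by blast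

lemma univ_ne: "\<exists>a. a \<in> univ A"
  using algebra by (auto simp: is_algebra_def)

lemma rho_Z: "\<rho> \<in> univ Z"
  using univ_ne cls_diag S_refl unfolding univ_Z by (metis image_eqI)

lemma interp_Z:
  assumes ss: "length ss = ar f" "set ss \<subseteq> S"
  shows "interp Z f (map cls ss) = cls (interp (A \<otimes> A) f ss)"
proof -
  define rep where "rep X = (SOME s. s \<in> X)" for X :: "('a \<times> 'a) set"
  have rep: "(rep (cls s), s) \<in> \<Theta>" if "s \<in> S" for s
  proof -
    have "s \<in> cls s" using that equiv_class_self[OF equiv] by (simp add: cls_def)
    then have "rep (cls s) \<in> cls s" unfolding rep_def by (rule someI)
    then show ?thesis using equiv by (auto simp: cls_def equiv_def dest: symD)
  qed
  have "interp ((A \<otimes> A) \<otimes> (A \<otimes> A)) f (map (\<lambda>s. (rep (cls s), s)) ss) \<in> \<Theta>"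
    using closed ss rep by (intro closed_underD) auto
  then have "(interp (A \<otimes> A) f (map rep (map cls ss)), interp (A \<otimes> A) f ss) \<in> \<Theta>"
    by (simp add: comp_def)
  then have "cls (interp (A \<otimes> A) f (map rep (map cls ss))) = cls (interp (A \<otimes> A) f ss)" by (rule cls_eqI)
  then show ?thesis unfolding Z_def rep_def[abs_def] by (simp del: map_map interp_prod)
qed

lemma hom_Z: "is_hom ar ((A \<otimes> A)\<lparr>univ := S\<rparr>) Z cls"
  using interp_Z by (auto simp: is_hom_def univ_Z)

lemma ex_map_cls: "set Xs \<subseteq> univ Z \<Longrightarrow> \<exists>ss. Xs = map cls ss \<and> set ss \<subseteq> S"
proof -
  assume "set Xs \<subseteq> univ Z"
  then have "Xs \<in> map cls ` lists S" unfolding lists_image[symmetric] univ_Z by auto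
  then show ?thesis by auto
qed

lemma closed_Z: "closed_under ar Z (univ Z)"
  unfolding closed_under_def
proof (intro allI impI, elim conjE)
  fix f Xs assume Xs: "length Xs = ar f" "set Xs \<subseteq> univ Z"
  then obtain ss where ss: "Xs = map cls ss" "set ss \<subseteq> S" using ex_map_cls by blast
  then have "interp (A \<otimes> A) f ss \<in> S" using Xs S_closed by (intro closed_underD) auto
  then show "interp Z f Xs \<in> univ Z" using interp_Z[of ss f] ss Xs by (simp add: univ_Z)
qed

lemma algebra_Z: "is_algebra ar Z"
  using closed_Z rho_Z by (auto simp: is_algebra_def)

lemma in_HS_Z: "in_HS ar (A \<otimes> A) Z"
  unfolding in_HS_def using algebra_Z S hom_Z univ_Z by blast

lemma rho_closed: "closed_under ar (A \<otimes> A) \<rho>"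
  using rho by (simp add: Con_def subuniverse_def)

lemma interp_Z_rho: "interp Z f (replicate (ar f) \<rho>) = \<rho>"
proof -
  obtain a where a: "a \<in> univ A" using univ_ne by blast
  have "interp Z f (map cls (replicate (ar f) (a, a))) = cls (interp (A \<otimes> A) f (replicate (ar f) (a, a)))"
    using S_refl[OF a] by (intro interp_Z) auto
  moreover have "interp (A \<otimes> A) f (replicate (ar f) (a, a)) \<in> \<rho>"
    using rho_refl[OF a] by (intro closed_underD[OF rho_closed]) auto
  ultimately show ?thesis using a by (simp add: cls_diag cls_rho del: interp_prod)
qed

lemma subuniverse_rho: "subuniverse ar Z {\<rho>}"
  unfolding subuniverse_def closed_under_def
proof (intro conjI allI impI)
  fix f Xs assume "length Xs = ar f \<and> set Xs \<subseteq> {\<rho>}"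
  then have "Xs = replicate (ar f) \<rho>" by (auto intro!: replicate_eqI)
  then show "interp Z f Xs \<in> {\<rho>}" using interp_Z_rho by simp
qed (simp add: rho_Z)

lemma term_op_Z:
  assumes "wf_trm ar (length ss) t" "set ss \<subseteq> S"
  shows "term_op Z t (map cls ss) = cls (term_op A t (map fst ss), term_op A t (map snd ss))"
proof -
  have "term_op Z t (map cls ss) = cls (term_op (A \<otimes> A) t ss)"
    using assms(1)
  proof (induction t)
    case (App f ts)
    then have "map (\<lambda>t. term_op Z t (map cls ss)) ts = map cls (map (\<lambda>t. term_op (A \<otimes> A) t ss) ts)"
      by auto
    moreover have "interp Z f (map cls (map (\<lambda>t. term_op (A \<otimes> A) t ss) ts)) =
        cls (interp (A \<otimes> A) f (map (\<lambda>t. term_op (A \<otimes> A) t ss) ts))"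
      using App.prems by (intro interp_Z) (auto simp del: split_paired_All simp: image_subset_iff intro!: term_op_closed[OF S_closed _ refl assms(2)])
    ultimately show ?case by (simp only: term_op.simps)
  qed auto
  then show ?thesis using assms(1) by (simp add: term_op_prod)
qed

lemma term_op_S:
  assumes "wf_trm ar (length ss) t" "set ss \<subseteq> S"
  shows "(term_op A t (map fst ss), term_op A t (map snd ss)) \<in> S"
  using term_op_closed[OF S_closed assms(1) refl assms(2)] assms(1) by (simp add: term_op_prod)

text \<open>A congruence \<open>\<theta>\<close> of \<open>Z\<close> pulls back to
  \<open>\<Theta>'\<close> on \<open>S\<close>. If \<open>\<rho>\<close> is still a class of
  \<open>\<Theta>'\<close>, maximality leaves \<open>\<Theta>' = \<Theta>\<close> and
  \<open>\<theta>\<close> is equality. Otherwise the class \<open>D\<close> of \<open>\<rho>\<close>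
  under \<open>\<Theta>'\<close> is a saturated subuniverse properly above \<open>\<rho>\<close>,
  hence all of \<open>S\<close>, and \<open>\<theta>\<close> is full.\<close>

lemma simple_Z:
  assumes min: "\<And>R. subuniverse ar (A \<otimes> A) R \<Longrightarrow> saturated \<rho> R \<Longrightarrow> \<rho> \<subset> R \<Longrightarrow> R \<subseteq> S \<Longrightarrow> R = S"
    and max: "\<And>\<Theta>'. equiv S \<Theta>' \<Longrightarrow> closed_under ar ((A \<otimes> A) \<otimes> (A \<otimes> A)) \<Theta>' \<Longrightarrow> \<Theta> \<subseteq> \<Theta>' \<Longrightarrow>
      (\<forall>(s, s')\<in>\<Theta>'. s \<in> \<rho> \<longrightarrow> s' \<in> \<rho>) \<Longrightarrow> \<Theta>' = \<Theta>"
  shows "simple_alg ar Z"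
proof -
  have "\<theta> = zero_con Z \<or> \<theta> = one_con Z" if \<theta>: "\<theta> \<in> Con ar Z" for \<theta>
  proof -
    have \<theta>_equiv: "equiv (univ Z) \<theta>" and \<theta>_closed: "closed_under ar (Z \<otimes> Z) \<theta>"
      using \<theta> by (auto simp: Con_def subuniverse_def)
    have \<theta>_sub: "\<theta> \<subseteq> univ Z \<times> univ Z" using \<theta>_equiv by (rule equiv_type)
    have \<theta>_refl: "X \<in> univ Z \<Longrightarrow> (X, X) \<in> \<theta>" for X
      using \<theta>_equiv by (simp add: equiv_def refl_on_def)
    define \<Theta>' where "\<Theta>' = {(s, s'). s \<in> S \<and> s' \<in> S \<and> (cls s, cls s') \<in> \<theta>}"
    show ?thesis
    proof (cases "\<forall>(s, s')\<in>\<Theta>'. s \<in> \<rho> \<longrightarrow> s' \<in> \<rho>")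
      case True
      have "\<Theta>' = \<Theta>"
      proof (rule max[OF _ _ _ True])
        show "equiv S \<Theta>'"
        proof (rule equivI)
          show "\<Theta>' \<subseteq> S \<times> S" by (auto simp: \<Theta>'_def)
          show "refl_on S \<Theta>'" using \<theta>_refl by (auto simp: \<Theta>'_def refl_on_def univ_Z)
          show "sym \<Theta>'" using \<theta>_equiv by (auto simp: \<Theta>'_def equiv_def intro!: symI dest: symD)
          show "trans \<Theta>'" using \<theta>_equiv unfolding \<Theta>'_def equiv_def trans_def by blast
        qed
        show "\<Theta> \<subseteq> \<Theta>'"
          using Theta_sub \<theta>_refl cls_eqI by (auto simp: \<Theta>'_def univ_Z)
        show "closed_under ar ((A \<otimes> A) \<otimes> (A \<otimes> A)) \<Theta>'"
          unfolding closed_under_def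
        proof (intro allI impI, elim conjE)
          fix f xs assume xs: "length xs = ar f" "set xs \<subseteq> \<Theta>'"
          then have sub: "set (map fst xs) \<subseteq> S" "set (map snd xs) \<subseteq> S" by (auto simp: \<Theta>'_def)
          have "interp (Z \<otimes> Z) f (map (\<lambda>x. (cls (fst x), cls (snd x))) xs) \<in> \<theta>"
            using xs by (intro closed_underD[OF \<theta>_closed]) (auto simp: \<Theta>'_def)
          then have "(interp Z f (map cls (map fst xs)), interp Z f (map cls (map snd xs))) \<in> \<theta>"
            by (simp add: comp_def)
          then have "(cls (interp (A \<otimes> A) f (map fst xs)), cls (interp (A \<otimes> A) f (map snd xs))) \<in> \<theta>"
            using interp_Z[OF _ sub(1)] interp_Z[OF _ sub(2)] xs by (simp del: map_map interp_prod)
          moreover have "interp (A \<otimes> A) f (map fst xs) \<in> S" "interp (A \<otimes> A) f (map snd xs) \<in> S"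
            using closed_underD[OF S_closed _ sub(1)] closed_underD[OF S_closed _ sub(2)] xs
            by (simp_all del: interp_prod)
          ultimately have "(interp (A \<otimes> A) f (map fst xs), interp (A \<otimes> A) f (map snd xs)) \<in> \<Theta>'"
            unfolding \<Theta>'_def by blast
          then show "interp ((A \<otimes> A) \<otimes> (A \<otimes> A)) f xs \<in> \<Theta>'" by simp
        qed
      qed
      have "X = Y" if XY: "(X, Y) \<in> \<theta>" for X Y
      proof -
        obtain s s' where "s \<in> S" "s' \<in> S" "X = cls s" "Y = cls s'"
          using XY \<theta>_sub unfolding univ_Z by blast
        then show ?thesis using XY \<open>\<Theta>' = \<Theta>\<close> cls_eqI unfolding \<Theta>'_def by blast
      qed
      then have "\<theta> \<subseteq> zero_con Z" using \<theta>_sub by (fastforce simp: Id_on_iff)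
      moreover have "zero_con Z \<subseteq> \<theta>" using \<theta>_refl by (auto simp: Id_on_def)
      ultimately show ?thesis by simp
    next
      case False
      then obtain s0 s1 where s01: "s0 \<in> \<rho>" "s1 \<in> S" "(cls s0, cls s1) \<in> \<theta>" "s1 \<notin> \<rho>"
        by (auto simp: \<Theta>'_def)
      define D where "D = {s \<in> S. (\<rho>, cls s) \<in> \<theta>}"
      have "D = S"
      proof (rule min)
        show "D \<subseteq> S" by (auto simp: D_def)
        have "\<rho> \<subseteq> D" using rho_S cls_rho \<theta>_refl rho_Z by (auto simp: D_def)
        moreover have "s1 \<in> D" using s01 by (simp add: D_def cls_rho)
        ultimately show "\<rho> \<subset> D" using s01 by blast
        show "subuniverse ar (A \<otimes> A) D"
          unfolding subuniverse_def closed_under_def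
        proof (intro conjI allI impI, goal_cases)
          case 1
          show ?case using S_sub by (auto simp: D_def)
        next
          case (2 f xs)
          then have xs: "length xs = ar f" "set xs \<subseteq> S" by (auto simp: D_def)
          \<comment> \<open>Constant first coordinates stay at \<open>\<rho>\<close> because
            \<open>{\<rho>}\<close> is a subuniverse of \<open>Z\<close>.\<close>
          have "interp (Z \<otimes> Z) f (map (\<lambda>s. (\<rho>, cls s)) xs) \<in> \<theta>"
            using 2 by (intro closed_underD[OF \<theta>_closed]) (auto simp: D_def)
          moreover have "map (\<lambda>s. \<rho>) xs = replicate (ar f) \<rho>" using xs by (simp add: map_replicate_const)
          ultimately have "(\<rho>, interp Z f (map cls xs)) \<in> \<theta>"
            using interp_Z_rho by (simp add: comp_def)
          then show ?case
            using interp_Z[OF xs] closed_underD[OF S_closed xs] by (simp add: D_def del: interp_prod)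
        qed
        have "(c, d) \<in> D" if "(a, b) \<in> D" "(a, c) \<in> \<rho>" "(b, d) \<in> \<rho>" for a b c d
        proof -
          have "((a, b), (c, d)) \<in> \<Theta>" using that sat by (auto simp: D_def)
          then show ?thesis using that cls_eqI Theta_sub by (auto simp: D_def)
        qed
        then have "\<rho> O D O \<rho> \<subseteq> D" using rho_sym by blast
        moreover have "D \<subseteq> \<rho> O D O \<rho>" using rho_refl S_sub by (force simp: D_def)
        ultimately show "saturated \<rho> D" unfolding saturated_def by blast
      qed
      then have "(\<rho>, X) \<in> \<theta>" if "X \<in> univ Z" for X using that by (auto simp: D_def univ_Z)
      then have "(X, Y) \<in> \<theta>" if "X \<in> univ Z" "Y \<in> univ Z" for X Y
        using that \<theta>_equiv unfolding equiv_def by (meson symD transD)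
      then have "\<theta> = one_con Z" using \<theta>_sub by auto
      then show ?thesis ..
    qed
  qed
  moreover have "zero_con Z \<in> Con ar Z"
  proof -
    have "equiv (univ Z) (zero_con Z)" 
      by (auto intro!: equivI refl_onI symI transI)
    moreover have "closed_under ar (Z \<otimes> Z) (zero_con Z)"
      unfolding closed_under_def
    proof (intro allI impI, elim conjE)
      fix f xs assume xs: "length xs = ar f" "set xs \<subseteq> zero_con Z"
      then have eq: "map fst xs = map snd xs" and "set (map snd xs) \<subseteq> univ Z" by auto
      then have "interp Z f (map snd xs) \<in> univ Z" using xs closed_Z by (simp add: closed_underD)
      then show "interp (Z \<otimes> Z) f xs \<in> zero_con Z"
        unfolding interp_prod eq by (rule Id_onI)
    qed
    ultimately show ?thesis by (auto simp: Con_def subuniverse_def)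
  qed
  moreover have "one_con Z \<in> Con ar Z"
  proof -
    have "equiv (univ Z) (one_con Z)" 
      by (auto intro!: equivI refl_onI symI transI)
    moreover have "closed_under ar (Z \<otimes> Z) (one_con Z)"
      unfolding closed_under_def
    proof (intro allI impI, elim conjE)
      fix f xs assume xs: "length xs = ar f" "set xs \<subseteq> one_con Z"
      then have "set (map fst xs) \<subseteq> univ Z" "set (map snd xs) \<subseteq> univ Z" by auto
      then show "interp (Z \<otimes> Z) f xs \<in> one_con Z"
        using closed_underD[OF closed_Z] xs by auto
    qed
    ultimately show ?thesis by (auto simp: Con_def subuniverse_def)
  qed
  moreover have "zero_con Z \<noteq> one_con Z"
  proof
    assume eq: "zero_con Z = one_con Z"
    obtain s where s: "s \<in> S" "s \<notin> \<rho>" using rho_S by blast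
    then have "(\<rho>, cls s) \<in> zero_con Z" using eq rho_Z by (auto simp: univ_Z)
    then have "cls s = \<rho>" by auto
    then show False using s cls_eq_rho[OF s(1)] by blast
  qed
  ultimately show ?thesis unfolding simple_alg_def by blast
qed

end

section \<open>Addition on \<open>Z\<close>, abelianness and the Maltsev identities\<close>

locale central_maltsev = central_congruence ar A \<rho> S \<Theta>
  for ar :: "'f \<Rightarrow> nat" and A :: "('f, 'a) alg" and \<rho> S \<Theta> +
  fixes p :: "'f trm"
  assumes wf_p: "wf_trm ar 3 p"
    and p_idem: "a \<in> univ A \<Longrightarrow> term_op A p [a, a, a] = a"
    and p_left: "(a, b) \<in> S \<Longrightarrow> (term_op A p [a, b, b], a) \<in> \<rho>"
    and p_right: "(a, b) \<in> S \<Longrightarrow> (term_op A p [b, b, a], a) \<in> \<rho>"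
begin

definition add :: "('a \<times> 'a) set \<Rightarrow> ('a \<times> 'a) set \<Rightarrow> ('a \<times> 'a) set"  (infixl "\<oplus>" 65) where
  "X \<oplus> Y = term_op Z p [X, \<rho>, Y]"

lemma term_op_p_Z:
  assumes "(a, a') \<in> S" "(b, b') \<in> S" "(c, c') \<in> S"
  shows "term_op Z p [cls (a, a'), cls (b, b'), cls (c, c')] =
    cls (term_op A p [a, b, c], term_op A p [a', b', c'])"
    "(term_op A p [a, b, c], term_op A p [a', b', c']) \<in> S"
  using term_op_Z[of "[(a, a'), (b, b'), (c, c')]" p] term_op_S[of "[(a, a'), (b, b'), (c, c')]" p]
    assms wf_p by (simp_all add: numeral_3_eq_3)

text \<open>Apply \<open>p\<close> coordinatewise to \<open>(a, b)\<close>, \<open>(b, b)\<close>,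
  \<open>(b, c)\<close>: by the Maltsev identities along \<open>S\<close> the result is
  \<open>\<rho>\<close>-related to \<open>(a, c)\<close> in each coordinate. In particular
  \<open>S\<close> is transitive.\<close>

lemma add_cls:
  assumes ab: "(a, b) \<in> S" and bc: "(b, c) \<in> S"
  shows "cls (a, b) \<oplus> cls (b, c) = cls (a, c)" "(a, c) \<in> S"
proof -
  have A: "a \<in> univ A" "b \<in> univ A" "c \<in> univ A" using ab bc S_sub by auto
  have *: "((term_op A p [a, b, b], term_op A p [b, b, c]), (a, c)) \<in> \<Theta>"
    using term_op_p_Z(2)[OF ab S_refl[OF A(2)] bc] p_left[OF ab] p_right[OF S_sym[OF bc]] by (rule sat)
  then show "(a, c) \<in> S" using Theta_sub by blast
  have "cls (a, b) \<oplus> cls (b, c) = term_op Z p [cls (a, b), cls (b, b), cls (b, c)]"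
    unfolding add_def by (simp add: cls_diag A)
  also have "\<dots> = cls (a, c)"
    using term_op_p_Z(1)[OF ab S_refl[OF A(2)] bc] cls_eqI[OF *] by simp
  finally show "cls (a, b) \<oplus> cls (b, c) = cls (a, c)" .
qed

lemma Z_E:
  assumes "X \<in> univ Z" obtains a b where "(a, b) \<in> S" "X = cls (a, b)" "a \<in> univ A" "b \<in> univ A"
  using assms S_sub by (auto simp: univ_Z)

lemma add_zero [simp]:
  assumes "X \<in> univ Z" shows "X \<oplus> \<rho> = X" "\<rho> \<oplus> X = X"
proof -
  obtain a b where ab: "(a, b) \<in> S" "X = cls (a, b)" "a \<in> univ A" "b \<in> univ A" using assms by (rule Z_E)
  show "X \<oplus> \<rho> = X" using add_cls[of a b b] ab S_refl by (simp add: cls_diag)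
  show "\<rho> \<oplus> X = X" using add_cls[of a a b] ab S_refl by (simp add: cls_diag)
qed

text \<open>For \<open>X = cls (a, b)\<close> and \<open>Y = cls (c, d)\<close> the middle point is
  \<open>p(b, a, c)\<close>: \<open>X \<oplus> \<rho>\<close>, with zeros represented by
  \<open>(a, a)\<close> and \<open>(c, c)\<close>, ends there, and \<open>\<rho> \<oplus> Y\<close>,
  with zeros \<open>(b, b)\<close> and \<open>(a, a)\<close>, starts there.\<close>

lemma add_rep:
  assumes "X \<in> univ Z" "Y \<in> univ Z"
  shows "\<exists>a m d. (a, m) \<in> S \<and> (m, d) \<in> S \<and> X = cls (a, m) \<and> Y = cls (m, d)"
proof -
  obtain a b where ab: "(a, b) \<in> S" "X = cls (a, b)" "a \<in> univ A" "b \<in> univ A" using assms(1) by (rule Z_E)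
  obtain c d where cd: "(c, d) \<in> S" "Y = cls (c, d)" "c \<in> univ A" "d \<in> univ A" using assms(2) by (rule Z_E)
  let ?P = "\<lambda>x y z. term_op A p [x, y, z]"
  note 1 = term_op_p_Z[OF ab(1) S_refl[OF ab(3)] S_refl[OF cd(3)]]
  note 2 = term_op_p_Z[OF S_refl[OF ab(4)] S_refl[OF ab(3)] cd(1)]
  have "X = cls (?P a a c, ?P b a c)" using add_zero(1)[OF assms(1)] 1(1) ab cd
    by (simp add: cls_diag add_def)
  moreover have "Y = cls (?P b a c, ?P b a d)" using add_zero(2)[OF assms(2)] 2(1) ab cd
    by (simp add: cls_diag add_def)
  ultimately show ?thesis using 1(2) 2(2) by blast
qed

text \<open>Writing the summands as \<open>cls (a, m)\<close> and \<open>cls (m, d)\<close>, the sum is \<open>cls (a, d)\<close>; this form is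
  respected by every term.\<close>

lemma term_op_add:
  assumes t: "wf_trm ar k t" and Xs: "length Xs = k" "set Xs \<subseteq> univ Z"
    and Ys: "length Ys = k" "set Ys \<subseteq> univ Z"
  shows "term_op Z t (map2 (\<oplus>) Xs Ys) = term_op Z t Xs \<oplus> term_op Z t Ys"
proof -
  have "\<forall>i<k. \<exists>a m d. (a, m) \<in> S \<and> (m, d) \<in> S \<and> Xs ! i = cls (a, m) \<and> Ys ! i = cls (m, d)"
    using Xs Ys by (intro allI impI add_rep) (auto simp: subset_code(1))
  then obtain a m d where rep: "\<And>i. i < k \<Longrightarrow>
      (a i, m i) \<in> S \<and> (m i, d i) \<in> S \<and> Xs ! i = cls (a i, m i) \<and> Ys ! i = cls (m i, d i)"
    by metis
  let ?am = "map (\<lambda>i. (a i, m i)) [0..<k]" and ?md = "map (\<lambda>i. (m i, d i)) [0..<k]"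
    and ?ad = "map (\<lambda>i. (a i, d i)) [0..<k]"
  let ?T = "\<lambda>x. term_op A t (map x [0..<k])"
  have eqs: "Xs = map cls ?am" "Ys = map cls ?md" "map2 (\<oplus>) Xs Ys = map cls ?ad"
    using Xs Ys rep by (auto intro!: nth_equalityI simp: add_cls)
  have "(a i, d i) \<in> S" if "i < k" for i using add_cls(2)[of "a i" "m i" "d i"] rep[OF that] by blast
  then have sub: "set ?am \<subseteq> S" "set ?md \<subseteq> S" "set ?ad \<subseteq> S" using rep by auto
  have "term_op Z t Xs = cls (?T a, ?T m)" "term_op Z t Ys = cls (?T m, ?T d)"
    "term_op Z t (map2 (\<oplus>) Xs Ys) = cls (?T a, ?T d)"
    "(?T a, ?T m) \<in> S" "(?T m, ?T d) \<in> S"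
    using term_op_Z[OF _ sub(1), of t] term_op_Z[OF _ sub(2), of t] term_op_Z[OF _ sub(3), of t]
      term_op_S[OF _ sub(1), of t] term_op_S[OF _ sub(2), of t] t
    unfolding eqs(3) unfolding eqs(1,2) by (simp_all add: comp_def)
  then show ?thesis by (simp add: add_cls)
qed

text \<open>\<open>p\<close> itself respects \<open>\<oplus>\<close>; evaluate it on the sum of
  \<open>[X, \<rho>, \<rho>]\<close> and \<open>[Y, \<rho>, W]\<close>.\<close>

lemma add_assoc:
  assumes "X \<in> univ Z" "Y \<in> univ Z" "W \<in> univ Z"
  shows "(X \<oplus> Y) \<oplus> W = X \<oplus> (Y \<oplus> W)"
  using term_op_add[OF wf_p, of "[X, \<rho>, \<rho>]" "[Y, \<rho>, W]"] assms rho_Z by (simp flip: add_def)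

lemma ex_minus:
  assumes "X \<in> univ Z" shows "\<exists>Y\<in>univ Z. X \<oplus> Y = \<rho> \<and> Y \<oplus> X = \<rho>"
proof -
  obtain a b where ab: "(a, b) \<in> S" "X = cls (a, b)" "a \<in> univ A" "b \<in> univ A" using assms by (rule Z_E)
  show ?thesis
    by (rule bexI[of _ "cls (b, a)"]) (use ab S_sym[OF ab(1)] in \<open>auto simp: add_cls cls_diag univ_Z\<close>)
qed

lemma add_left_cancel:
  assumes "X \<oplus> Y = X \<oplus> W" "X \<in> univ Z" "Y \<in> univ Z" "W \<in> univ Z" shows "Y = W"
  by (metis add_assoc add_zero(2) assms ex_minus)

lemma add_right_cancel:
  assumes "Y \<oplus> X = W \<oplus> X" "X \<in> univ Z" "Y \<in> univ Z" "W \<in> univ Z" shows "Y = W"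
  by (metis add_assoc add_zero(1) assms ex_minus)

text \<open>Writing \<open>0\<close> for \<open>\<rho>\<close>, additivity splits
  \<open>t(U, Es)\<close> into \<open>t(U, 0) \<oplus> t(0, Es)\<close>; by cancellation, whether
  two values with the same \<open>U\<close> agree depends only on the second summands.\<close>

lemma abelian_Z: "abelian ar Z"
  unfolding abelian_def
proof (intro allI impI ballI, elim conjE)
  fix n t X Y Cs Ds
  assume t: "wf_trm ar (Suc n) t" and X: "X \<in> univ Z" and Y: "Y \<in> univ Z"
    and len: "length Cs = n" "length Ds = n" and Cs: "set Cs \<subseteq> univ Z" and Ds: "set Ds \<subseteq> univ Z"
    and eq: "term_op Z t (X # Cs) = term_op Z t (X # Ds)"
  let ?O = "replicate n \<rho>"
  have O: "set ?O \<subseteq> univ Z" using rho_Z by (intro subsetI) simp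
  have split: "term_op Z t (U # Es) = term_op Z t (U # ?O) \<oplus> term_op Z t (\<rho> # Es)"
    if "U \<in> univ Z" "length Es = n" "set Es \<subseteq> univ Z" for U Es
  proof -
    have "map2 (\<oplus>) ?O Es = Es" using that by (intro nth_equalityI) (auto simp: subset_code(1))
    then show ?thesis
      using term_op_add[OF t, of "U # ?O" "\<rho> # Es"] that rho_Z O by simp
  qed
  have cl: "term_op Z t (U # Es) \<in> univ Z" if "U \<in> univ Z" "length Es = n" "set Es \<subseteq> univ Z" for U Es
    using that by (intro term_op_closed[OF closed_Z t]) auto
  have "term_op Z t (\<rho> # Cs) = term_op Z t (\<rho> # Ds)"
    by (rule add_left_cancel[of "term_op Z t (X # ?O)"])
      (use eq split[OF X len(1) Cs] split[OF X len(2) Ds] X len Cs Ds rho_Z in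
        \<open>simp_all add: cl O\<close>)
  then show "term_op Z t (Y # Cs) = term_op Z t (Y # Ds)"
    using split[OF Y len(1) Cs] split[OF Y len(2) Ds] by simp
qed

text \<open>Write \<open>0\<close> for \<open>\<rho>\<close>. Cancelling in
  \<open>p(Y, Y, 0) \<oplus> p(0, 0, Y) = p(Y, Y, Y) = Y\<close> gives
  \<open>p(Y, Y, 0) = 0\<close>, and adding \<open>p(0, 0, X) = X\<close> gives
  \<open>p(Y, Y, X) = X\<close>; likewise on the other side.\<close>

lemma maltsev_Z: "maltsev_term ar Z p"
  unfolding maltsev_term_def
proof (intro conjI ballI wf_p)
  have idem: "term_op Z p [X, X, X] = X" if X: "X \<in> univ Z" for X
  proof -
    obtain a b where ab: "(a, b) \<in> S" "X = cls (a, b)" "a \<in> univ A" "b \<in> univ A" using X by (rule Z_E)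
    then show ?thesis using term_op_p_Z(1)[OF ab(1) ab(1) ab(1)] by (simp add: p_idem)
  qed
  have cl: "term_op Z p [X, Y, W] \<in> univ Z" if "X \<in> univ Z" "Y \<in> univ Z" "W \<in> univ Z" for X Y W
    using that by (intro term_op_closed[OF closed_Z wf_p]) auto
  have sum: "term_op Z p [X \<oplus> X', Y \<oplus> Y', W \<oplus> W'] = term_op Z p [X, Y, W] \<oplus> term_op Z p [X', Y', W']"
    if "X \<in> univ Z" "Y \<in> univ Z" "W \<in> univ Z" "X' \<in> univ Z" "Y' \<in> univ Z" "W' \<in> univ Z" for X Y W X' Y' W'
    using term_op_add[OF wf_p, of "[X, Y, W]" "[X', Y', W']"] that by simp
  fix X Y assume X: "X \<in> univ Z" and Y: "Y \<in> univ Z"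
  have unit: "term_op Z p [X, \<rho>, \<rho>] = X" "term_op Z p [\<rho>, \<rho>, X] = X" if "X \<in> univ Z" for X
    using add_zero[OF that] by (simp_all add: add_def)
  have "term_op Z p [Y, Y, \<rho>] = \<rho>"
    by (rule add_right_cancel[of _ Y])
      (use sum[of Y Y \<rho> \<rho> \<rho> Y] idem[OF Y] unit(2)[OF Y] Y rho_Z cl in auto)
  then show "term_op Z p [Y, Y, X] = X"
    using sum[of Y Y \<rho> \<rho> \<rho> X] X Y rho_Z unit(2)[OF X] by simp
  have "term_op Z p [\<rho>, Y, Y] = \<rho>"
    by (rule add_left_cancel[of Y])
      (use sum[of Y \<rho> \<rho> \<rho> Y Y] idem[OF Y] unit(1)[OF Y] Y rho_Z cl in auto)
  then show "term_op Z p [X, Y, Y] = X"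
    using sum[of X \<rho> \<rho> \<rho> Y Y] X Y rho_Z unit(1)[OF X] by simp
qed

lemma affine_Z: "affine ar Z"
  unfolding affine_def using abelian_Z maltsev_Z by blast

end

section \<open>Bridges as relations on pairs\<close>

lemma closed_pairD:
  assumes "closed_under ar (X \<otimes> Y) R" "length zs = ar f" "\<And>z. z \<in> set zs \<Longrightarrow> (g z, h z) \<in> R"
  shows "(interp X f (map g zs), interp Y f (map h zs)) \<in> R"
  using closed_underD[OF assms(1), of "map (\<lambda>z. (g z, h z)) zs" f] assms(2,3) by (auto simp: comp_def)

lemma closed_relcomp:
  assumes "closed_under ar (X \<otimes> Y) R" "closed_under ar (Y \<otimes> W) R'"
  shows "closed_under ar (X \<otimes> W) (R O R')"
  unfolding closed_under_def
proof (intro allI impI, elim conjE)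
  fix f xs assume xs: "length xs = ar f" "set xs \<subseteq> R O R'"
  then have "\<forall>x\<in>set xs. \<exists>y. (fst x, y) \<in> R \<and> (y, snd x) \<in> R'" by force
  then obtain c where "\<forall>x\<in>set xs. (fst x, c x) \<in> R \<and> (c x, snd x) \<in> R'" by metis
  then show "interp (X \<otimes> W) f xs \<in> R O R'"
    using closed_pairD[OF assms(1) xs(1), of fst c] closed_pairD[OF assms(2) xs(1), of c snd] by auto
qed

lemma closed_converse:
  assumes "closed_under ar (X \<otimes> Y) R" shows "closed_under ar (Y \<otimes> X) (R\<inverse>)"
  unfolding closed_under_def
proof (intro allI impI, elim conjE)
  fix f xs assume xs: "length xs = ar f" "set xs \<subseteq> R\<inverse>"
  then have "(snd x, fst x) \<in> R" if "x \<in> set xs" for x using that by auto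
  from closed_pairD[OF assms xs(1) this] show "interp (Y \<otimes> X) f xs \<in> R\<inverse>" by simp
qed

text \<open>\<open>A \<otimes> A \<otimes> A \<otimes> A\<close> nests to the right, so a bridge
  becomes a relation between pairs only after regrouping.\<close>

definition quad :: "(('a \<times> 'a) \<times> ('a \<times> 'a)) set \<Rightarrow> ('a \<times> 'a \<times> 'a \<times> 'a) set" where
  "quad R = {(a, b, c, d). ((a, b), (c, d)) \<in> R}"

lemma quad_surj: "\<exists>R. T = quad R"
  by (rule exI[of _ "{((a, b), (c, d)). (a, b, c, d) \<in> T}"]) (auto simp: quad_def)

lemma closed_quad:
  "closed_under ar (A \<otimes> A \<otimes> A \<otimes> A) (quad R) \<longleftrightarrow> closed_under ar ((A \<otimes> A) \<otimes> (A \<otimes> A)) R"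
proof
  assume cl: "closed_under ar ((A \<otimes> A) \<otimes> (A \<otimes> A)) R"
  show "closed_under ar (A \<otimes> A \<otimes> A \<otimes> A) (quad R)"
    unfolding closed_under_def
  proof (intro allI impI, elim conjE)
    fix f xs assume xs: "length xs = ar f" "set xs \<subseteq> quad R"
    then have "((fst x, fst (snd x)), snd (snd x)) \<in> R" if "x \<in> set xs" for x
      using that by (auto simp: quad_def)
    from closed_pairD[OF cl xs(1) this] show "interp (A \<otimes> A \<otimes> A \<otimes> A) f xs \<in> quad R"
      by (simp add: quad_def comp_def)
  qed
next
  assume cl: "closed_under ar (A \<otimes> A \<otimes> A \<otimes> A) (quad R)"
  show "closed_under ar ((A \<otimes> A) \<otimes> (A \<otimes> A)) R"
    unfolding closed_under_def
  proof (intro allI impI, elim conjE)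
    fix f xs assume xs: "length xs = ar f" "set xs \<subseteq> R"
    then have "(fst (fst x), (snd (fst x), snd x)) \<in> quad R" if "x \<in> set xs" for x
      using that by (auto simp: quad_def)
    from closed_pairD[OF cl xs(1) this] show "interp ((A \<otimes> A) \<otimes> (A \<otimes> A)) f xs \<in> R"
      by (simp add: quad_def comp_def)
  qed
qed

locale irreducible_congruence =
  fixes ar :: "'f \<Rightarrow> nat" and A :: "('f, 'a) alg" and \<rho> S :: "('a \<times> 'a) set"
  assumes algebra: "is_algebra ar A"
    and finite_A: "finite (univ A)"
    and irreducible: "irreducible_con ar A \<rho>"
    and S_star: "S = star ar A \<rho>"
begin

section \<open>The unique cover \<open>S\<close> of \<open>\<rho>\<close>\<close>

lemma rho_Con: "\<rho> \<in> Con ar A"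
  using irreducible by (simp add: irreducible_con_def)

lemma rho_equiv: "equiv (univ A) \<rho>"
  and rho_closed: "closed_under ar (A \<otimes> A) \<rho>"
  using rho_Con by (simp_all add: Con_def subuniverse_def)

lemma rho_refl: "a \<in> univ A \<Longrightarrow> (a, a) \<in> \<rho>"
  using rho_equiv by (simp add: equiv_def refl_on_def)

lemma rho_sym: "(a, b) \<in> \<rho> \<Longrightarrow> (b, a) \<in> \<rho>"
  using rho_equiv by (meson equiv_def symE)

lemma rho_trans: "(a, b) \<in> \<rho> \<Longrightarrow> (b, c) \<in> \<rho> \<Longrightarrow> (a, c) \<in> \<rho>"
  using rho_equiv by (meson equiv_def transE)

lemma rho_converse: "\<rho>\<inverse> = \<rho>"
  using rho_sym by auto

abbreviation sat_above :: "('a \<times> 'a) set \<Rightarrow> bool" where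
  "sat_above R \<equiv> subuniverse ar (A \<otimes> A) R \<and> saturated \<rho> R \<and> \<rho> \<subset> R"

lemma Cov_S: "Cov ar A \<rho> = {S}"
proof -
  obtain X where "Cov ar A \<rho> = {X}"
    using irreducible unfolding irreducible_con_def by (metis card_1_singletonE)
  then show ?thesis by (simp add: S_star star_def)
qed

lemma S_props: "sat_above S"
  using Cov_S by (auto simp: Cov_def Let_def)

lemma S_minimal:
  assumes "sat_above R" "R \<subseteq> S" shows "R = S"
proof -
  have "S \<in> Cov ar A \<rho>" using Cov_S by simp
  then have "\<not> R \<subset> S" using assms(1) unfolding Cov_def Let_def by blast
  then show ?thesis using assms(2) by blast
qed

lemma sat_above_converse:
  assumes "sat_above R" shows "sat_above (R\<inverse>)"
proof -
  have "R\<inverse> = (\<rho> O R O \<rho>)\<inverse>" using assms unfolding saturated_def by metis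
  then have "saturated \<rho> (R\<inverse>)" unfolding saturated_def by (simp add: converse_relcomp rho_converse O_assoc)
  moreover have "\<rho>\<inverse> \<subset> R\<inverse>" using assms by (metis converse_converse converse_mono psubset_eq)
  ultimately show ?thesis
    using assms closed_converse[of ar A A R] by (auto simp: subuniverse_def rho_converse)
qed

text \<open>Taking converses permutes the saturated subuniverses properly above
  \<open>\<rho>\<close> and respects inclusion, so \<open>S\<inverse>\<close> is minimal as well;
  the cover is unique.\<close>

lemma S_converse: "S\<inverse> = S"
proof -
  have "\<not> R \<subset> S\<inverse>" if "sat_above R" for R
  proof
    assume "R \<subset> S\<inverse>"
    then have "R\<inverse> \<subset> S" by (metis converse_converse converse_mono psubset_eq)
    with S_minimal[OF sat_above_converse[OF that]] show False by blast
  qed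
  then have "S\<inverse> \<in> Cov ar A \<rho>"
    using sat_above_converse[OF S_props] unfolding Cov_def Let_def by blast
  then show ?thesis using Cov_S by simp
qed

lemma S_sub: "S \<subseteq> univ A \<times> univ A"
  and S_closed: "closed_under ar (A \<otimes> A) S"
  using S_props by (simp_all add: subuniverse_def)

lemma S_sat: "(a, b) \<in> S \<Longrightarrow> (a, c) \<in> \<rho> \<Longrightarrow> (b, d) \<in> \<rho> \<Longrightarrow> (c, d) \<in> S"
  using S_props rho_sym unfolding saturated_def by blast

text \<open>The congruence of \<open>A \<otimes> A\<close> that is \<open>\<rho>\<close> in each
  coordinate, restricted to \<open>S\<close>.\<close>

definition Sat :: "(('a \<times> 'a) \<times> ('a \<times> 'a)) set" where
  "Sat = {((a, b), (c, d)). (a, b) \<in> S \<and> (a, c) \<in> \<rho> \<and> (b, d) \<in> \<rho>}"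

lemma Sat_sub: "Sat \<subseteq> S \<times> S"
  using S_sat by (auto simp: Sat_def)

lemma Sat_refl: "s \<in> S \<Longrightarrow> (s, s) \<in> Sat"
  using S_sub rho_refl by (cases s) (auto simp: Sat_def)

lemma Sat_sym: "(s, s') \<in> Sat \<Longrightarrow> (s', s) \<in> Sat"
  using S_sat rho_sym by (cases s, cases s') (auto simp: Sat_def)

lemma Sat_trans: "(s, s') \<in> Sat \<Longrightarrow> (s', s'') \<in> Sat \<Longrightarrow> (s, s'') \<in> Sat"
  using rho_trans by (cases s, cases s', cases s'') (auto simp: Sat_def)

lemma Sat_rho: "(s, s') \<in> Sat \<Longrightarrow> s \<in> \<rho> \<longleftrightarrow> s' \<in> \<rho>"
proof -
  have *: "s' \<in> \<rho>" if "(s, s') \<in> Sat" "s \<in> \<rho>" for s s'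
  proof -
    obtain a b c d where "s = (a, b)" "s' = (c, d)" by (cases s, cases s')
    then show ?thesis
      using that rho_trans[OF rho_sym[of a c] rho_trans[of a b d]] by (simp add: Sat_def)
  qed
  assume "(s, s') \<in> Sat"
  then show ?thesis using *[of s s'] *[of s' s] Sat_sym by blast
qed

lemma Sat_closed: "closed_under ar ((A \<otimes> A) \<otimes> (A \<otimes> A)) Sat"
  unfolding closed_under_def
proof (intro allI impI, elim conjE)
  fix f xs assume xs: "length xs = ar f" "set xs \<subseteq> Sat"
  then have "(fst (fst x), snd (fst x)) \<in> S" "(fst (fst x), fst (snd x)) \<in> \<rho>" "(snd (fst x), snd (snd x)) \<in> \<rho>"
    if "x \<in> set xs" for x using that by (auto simp: Sat_def)
  from closed_pairD[OF S_closed xs(1) this(1)] closed_pairD[OF rho_closed xs(1) this(2)]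
    closed_pairD[OF rho_closed xs(1) this(3)]
  show "interp ((A \<otimes> A) \<otimes> (A \<otimes> A)) f xs \<in> Sat"
    by (simp add: Sat_def comp_def)
qed

section \<open>Bridges on \<open>S\<close> and the trace \<open>Opt\<close>\<close>

text \<open>Bridges competing in \<open>Opt\<close>, read as relations on \<open>S = \<rho>\<^sup>*\<close>; composition with \<open>Sat\<close> on both
  sides expresses (B0*).\<close>

definition bridge_rel :: "(('a \<times> 'a) \<times> ('a \<times> 'a)) set \<Rightarrow> bool" where
  "bridge_rel R \<longleftrightarrow> closed_under ar ((A \<otimes> A) \<otimes> (A \<otimes> A)) R \<and> Domain R = S \<and> Range R = S \<and>
     Sat O R O Sat \<subseteq> R \<and> (\<forall>(s, s')\<in>R. s \<in> \<rho> \<longleftrightarrow> s' \<in> \<rho>) \<and> (\<forall>a\<in>univ A. ((a, a), (a, a)) \<in> R)"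

lemma bridge_rel_Sat_closed:
  assumes "bridge_rel R" "(s, s') \<in> R" "(t, s) \<in> Sat" "(s', t') \<in> Sat" shows "(t, t') \<in> R"
proof -
  have "Sat O R O Sat \<subseteq> R" using assms(1) by (simp add: bridge_rel_def)
  then show ?thesis using assms(2-4) by blast
qed

lemma bridge_rel_rho: "bridge_rel R \<Longrightarrow> (s, s') \<in> R \<Longrightarrow> s \<in> \<rho> \<longleftrightarrow> s' \<in> \<rho>"
  by (auto simp: bridge_rel_def)

lemma pr_quad:
  shows "pr12 (quad R) = Domain R" and "pr34 (quad R) = Range R"
  by (force simp: pr12_def pr34_def quad_def image_iff)+

text \<open>The two forms of closure under \<open>\<rho>\<close> agree: a move by \<open>Sat\<close>
  amounts to two single replacements, and a single replacement is a move by \<open>Sat\<close> that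
  fixes the other coordinate.\<close>

lemma bridge_quad:
  "bridge ar A \<rho> (quad R) \<and> zero_con A \<subseteq> tr (quad R) \<and> pr12 (quad R) = S \<and> pr34 (quad R) = S
    \<longleftrightarrow> bridge_rel R"
proof
  assume *: "bridge ar A \<rho> (quad R) \<and> zero_con A \<subseteq> tr (quad R) \<and> pr12 (quad R) = S \<and> pr34 (quad R) = S"
  then have dr: "Domain R = S" "Range R = S" by (simp_all add: pr_quad)
  have B0: "((a1, a2), (b1, b2)) \<in> R \<Longrightarrow>
        ((a1, c) \<in> \<rho> \<longrightarrow> ((c, a2), (b1, b2)) \<in> R) \<and>
        ((a2, c) \<in> \<rho> \<longrightarrow> ((a1, c), (b1, b2)) \<in> R) \<and>
        ((b1, c) \<in> \<rho> \<longrightarrow> ((a1, a2), (c, b2)) \<in> R) \<and>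
        ((b2, c) \<in> \<rho> \<longrightarrow> ((a1, a2), (b1, c)) \<in> R)" for a1 a2 b1 b2 c
    using * unfolding bridge_def quad_def by blast
  have "Sat O R O Sat \<subseteq> R"
  proof
    fix z assume "z \<in> Sat O R O Sat"
    then obtain a b a' b' c d c' d' where z: "z = ((a', b'), (c', d'))"
      and R: "((a, b), (c, d)) \<in> R"
      and *: "(a', a) \<in> \<rho>" "(b', b) \<in> \<rho>" "(c, c') \<in> \<rho>" "(d, d') \<in> \<rho>"
      by (auto simp: Sat_def)
    have "((a', b'), (c, d)) \<in> R" using B0 R * rho_sym by blast
    then show "z \<in> R" unfolding z using B0 * by blast
  qed
  moreover have "closed_under ar ((A \<otimes> A) \<otimes> (A \<otimes> A)) R"
    using * unfolding bridge_def subuniverse_def closed_quad by blast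
  moreover have "\<forall>(s, s')\<in>R. s \<in> \<rho> \<longleftrightarrow> s' \<in> \<rho>"
  proof clarify
    fix a b c d assume "((a, b), (c, d)) \<in> R"
    then have "(a, b, c, d) \<in> quad R" by (simp add: quad_def)
    then show "(a, b) \<in> \<rho> \<longleftrightarrow> (c, d) \<in> \<rho>" using * unfolding bridge_def by blast
  qed
  moreover have "\<forall>a\<in>univ A. ((a, a), (a, a)) \<in> R"
  proof
    fix a assume "a \<in> univ A"
    then have "(a, a) \<in> tr (quad R)" using * by blast
    then show "((a, a), (a, a)) \<in> R" by (simp add: tr_def quad_def)
  qed
  ultimately show "bridge_rel R" using dr by (simp add: bridge_rel_def)
next
  assume R: "bridge_rel R"
  have RS: "R \<subseteq> S \<times> S" using R by (auto simp: bridge_rel_def)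
  note move = bridge_rel_Sat_closed[OF R]
  have B0: "((a1, c) \<in> \<rho> \<longrightarrow> ((c, a2), (b1, b2)) \<in> R) \<and>
        ((a2, c) \<in> \<rho> \<longrightarrow> ((a1, c), (b1, b2)) \<in> R) \<and>
        ((b1, c) \<in> \<rho> \<longrightarrow> ((a1, a2), (c, b2)) \<in> R) \<and>
        ((b2, c) \<in> \<rho> \<longrightarrow> ((a1, a2), (b1, c)) \<in> R)"
    if *: "((a1, a2), (b1, b2)) \<in> R" for a1 a2 b1 b2 c
  proof -
    have S: "(a1, a2) \<in> S" "(b1, b2) \<in> S" using RS * by auto
    then have refl: "((a1, a2), (a1, a2)) \<in> Sat" "((b1, b2), (b1, b2)) \<in> Sat" by (simp_all add: Sat_refl)
    have A: "(a1, a1) \<in> \<rho>" "(a2, a2) \<in> \<rho>" "(b1, b1) \<in> \<rho>" "(b2, b2) \<in> \<rho>"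
      using S S_sub rho_refl by auto
    have "((c, a2), (a1, a2)) \<in> Sat" if "(a1, c) \<in> \<rho>"
      by (rule Sat_sym) (use S A that in \<open>simp add: Sat_def\<close>)
    moreover have "((a1, c), (a1, a2)) \<in> Sat" if "(a2, c) \<in> \<rho>"
      by (rule Sat_sym) (use S A that in \<open>simp add: Sat_def\<close>)
    moreover have "((b1, b2), (c, b2)) \<in> Sat" if "(b1, c) \<in> \<rho>"
      using S A that by (simp add: Sat_def)
    moreover have "((b1, b2), (b1, c)) \<in> Sat" if "(b2, c) \<in> \<rho>"
      using S A that by (simp add: Sat_def)
    ultimately show ?thesis using move[OF *] refl by blast
  qed
  have sub: "subuniverse ar (A \<otimes> A \<otimes> A \<otimes> A) (quad R)"
    unfolding subuniverse_def closed_quad using R RS S_sub by (auto simp: bridge_rel_def quad_def)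
  have dr: "Domain R = S" "Range R = S" and rho_S: "\<rho> \<subset> S"
    using R S_props by (simp_all add: bridge_rel_def)
  have zero: "zero_con A \<subseteq> tr (quad R)" using R by (auto simp: bridge_rel_def tr_def quad_def)
  have B2: "\<forall>a1 a2 b1 b2. ((a1, a2), (b1, b2)) \<in> R \<longrightarrow> ((a1, a2) \<in> \<rho> \<longleftrightarrow> (b1, b2) \<in> \<rho>)"
    using R unfolding bridge_rel_def by blast
  have quad: "(a, b, c, d) \<in> quad R \<longleftrightarrow> ((a, b), (c, d)) \<in> R" for a b c d by (simp add: quad_def)
  have "bridge ar A \<rho> (quad R)"
    unfolding bridge_def pr_quad dr quad
  proof (intro conjI sub rho_S B2)
    show "\<forall>a1 a2 b1 b2 c. ((a1, a2), (b1, b2)) \<in> R \<longrightarrow>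
        ((a1, c) \<in> \<rho> \<longrightarrow> ((c, a2), (b1, b2)) \<in> R) \<and>
        ((a2, c) \<in> \<rho> \<longrightarrow> ((a1, c), (b1, b2)) \<in> R) \<and>
        ((b1, c) \<in> \<rho> \<longrightarrow> ((a1, a2), (c, b2)) \<in> R) \<and>
        ((b2, c) \<in> \<rho> \<longrightarrow> ((a1, a2), (b1, c)) \<in> R)"
      by (intro allI impI) (rule B0)
  qed
  then show "bridge ar A \<rho> (quad R) \<and> zero_con A \<subseteq> tr (quad R) \<and> pr12 (quad R) = S \<and> pr34 (quad R) = S"
    unfolding pr_quad using zero dr by blast
qed

lemma bridge_rel_Sat: "bridge_rel Sat"
proof -
  have "Domain Sat = S" "Range Sat = S" using Sat_sub Sat_refl by fast+
  moreover have "\<forall>a\<in>univ A. ((a, a), (a, a)) \<in> Sat"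
    using S_props rho_refl Sat_refl by blast
  moreover have "Sat O Sat O Sat \<subseteq> Sat" using Sat_trans by blast
  moreover have "\<forall>(s, s')\<in>Sat. s \<in> \<rho> \<longleftrightarrow> s' \<in> \<rho>" using Sat_rho by blast
  ultimately show ?thesis using Sat_closed by (simp add: bridge_rel_def)
qed

lemma bridge_rel_comp:
  assumes R: "bridge_rel R" and R': "bridge_rel R'" shows "bridge_rel (R O R')"
proof -
  have dr: "Domain R = S" "Range R = S" "Domain R' = S" "Range R' = S"
    using R R' by (simp_all add: bridge_rel_def)
  have "Domain (R O R') = S" "Range (R O R') = S" using dr by blast+
  moreover have "closed_under ar ((A \<otimes> A) \<otimes> (A \<otimes> A)) (R O R')"
    using R R' by (intro closed_relcomp[where Y = "A \<otimes> A"]) (simp_all add: bridge_rel_def)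
  moreover have "Sat O (R O R') O Sat \<subseteq> R O R'"
  proof
    fix z assume "z \<in> Sat O (R O R') O Sat"
    then obtain s t u v w where z: "z = (s, w)" "(s, t) \<in> Sat" "(t, u) \<in> R" "(u, v) \<in> R'" "(v, w) \<in> Sat"
      by blast
    have "(u, u) \<in> Sat" using z dr Sat_refl by blast
    then have "(s, u) \<in> R" "(u, w) \<in> R'"
      using bridge_rel_Sat_closed[OF R z(3,2)] bridge_rel_Sat_closed[OF R' z(4) _ z(5)] by blast+
    then show "z \<in> R O R'" using z by blast
  qed
  moreover have "\<forall>(s, s')\<in>R O R'. s \<in> \<rho> \<longleftrightarrow> s' \<in> \<rho>"
    using bridge_rel_rho[OF R] bridge_rel_rho[OF R'] by blast
  moreover have "\<forall>a\<in>univ A. ((a, a), (a, a)) \<in> R O R'"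
  proof
    fix a assume "a \<in> univ A"
    then have "((a, a), (a, a)) \<in> R" "((a, a), (a, a)) \<in> R'" using R R' by (simp_all add: bridge_rel_def)
    then show "((a, a), (a, a)) \<in> R O R'" ..
  qed
  ultimately show ?thesis by (simp add: bridge_rel_def)
qed

text \<open>The set of traces is finite and directed because bridges can be composed, so \<open>Opt\<close>, defined
  by \<open>GREATEST\<close>, is the trace of a bridge.\<close>

lemma Opt_bridge_rel: "\<exists>R. bridge_rel R \<and> Opt ar A \<rho> = {(a, b). ((a, a), (b, b)) \<in> R}"
proof -
  define trace where "trace R = {(a, b). ((a, a), (b, b)) \<in> R}" for R :: "(('a \<times> 'a) \<times> ('a \<times> 'a)) set"
  define P where "P X \<longleftrightarrow> (\<exists>R. X = trace R \<and> bridge_rel R)" for X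
  have tr: "tr (quad R) = trace R" for R by (auto simp: tr_def quad_def trace_def)
  have "Opt ar A \<rho> = Greatest P"
    unfolding Opt_def S_star[symmetric]
  proof (rule arg_cong[where f = Greatest], rule ext)
    fix X
    show "(\<exists>T. X = tr T \<and> bridge ar A \<rho> T \<and> zero_con A \<subseteq> tr T \<and> pr12 T = S \<and> pr34 T = S) = P X"
      unfolding P_def using bridge_quad tr quad_surj by metis
  qed
  have trace_sub: "trace R \<subseteq> univ A \<times> univ A" if "bridge_rel R" for R
  proof -
    have "Domain R = S" "Range R = S" using that by (simp_all add: bridge_rel_def)
    then show ?thesis using S_sub unfolding trace_def by fast
  qed
  have "finite {X. P X}"
    by (rule finite_subset[of _ "Pow (univ A \<times> univ A)"]) (use trace_sub finite_A in \<open>auto simp: P_def\<close>)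
  moreover have "trace Sat \<in> {X. P X}" using bridge_rel_Sat by (auto simp: P_def)
  ultimately obtain X where X: "P X" "\<And>Y. P Y \<Longrightarrow> X \<subseteq> Y \<Longrightarrow> X = Y"
    by (metis finite_has_maximal2 mem_Collect_eq)
  \<comment> \<open>Both bridges contain the quadruples \<open>((a, a), (a, a))\<close>, so the
    trace of their composition contains \<open>X\<close> and \<open>Y\<close>; maximality makes it
    equal to \<open>X\<close>.\<close>
  have "Y \<subseteq> X" if Y: "P Y" for Y
  proof -
    obtain R R' where R: "X = trace R" "bridge_rel R" "Y = trace R'" "bridge_rel R'"
      using X(1) Y by (auto simp: P_def)
    have refl: "((a, a), (a, a)) \<in> R" "((a, a), (a, a)) \<in> R'" if "a \<in> univ A" for a
      using R that by (auto simp: bridge_rel_def)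
    have "X \<subseteq> trace (R O R')"
    proof (rule subrelI)
      fix a b assume "(a, b) \<in> X"
      then have "((a, a), (b, b)) \<in> R" "b \<in> univ A" using R(1) trace_sub[OF R(2)] by (auto simp: trace_def)
      then show "(a, b) \<in> trace (R O R')" unfolding trace_def using refl(2) by blast
    qed
    moreover have "Y \<subseteq> trace (R O R')"
    proof (rule subrelI)
      fix a b assume "(a, b) \<in> Y"
      then have "((a, a), (b, b)) \<in> R'" "a \<in> univ A" using R(3) trace_sub[OF R(4)] by (auto simp: trace_def)
      then show "(a, b) \<in> trace (R O R')" unfolding trace_def using refl(1) by blast
    qed
    moreover have "P (trace (R O R'))" using bridge_rel_comp R by (auto simp: P_def)
    ultimately show ?thesis using X(2) by blast
  qed
  then have "Greatest P = X" using X(1) by (intro Greatest_equality)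
  with X(1) \<open>Opt ar A \<rho> = Greatest P\<close> show ?thesis by (auto simp: P_def trace_def)
qed

text \<open>What is demanded of \<open>\<Theta>\<close> apart from symmetry and transitivity, which
  a maximal such relation acquires; reflexivity on \<open>S\<close> is part of
  \<open>Sat \<subseteq> R\<close>.\<close>

definition central_rel :: "(('a \<times> 'a) \<times> ('a \<times> 'a)) set \<Rightarrow> bool" where
  "central_rel R \<longleftrightarrow> R \<subseteq> S \<times> S \<and> closed_under ar ((A \<otimes> A) \<otimes> (A \<otimes> A)) R \<and> Sat \<subseteq> R \<and> \<rho> \<times> \<rho> \<subseteq> R \<and>
     (\<forall>(s, s')\<in>R. s \<in> \<rho> \<longleftrightarrow> s' \<in> \<rho>)"

lemma central_rel_rho: "central_rel R \<Longrightarrow> (s, s') \<in> R \<Longrightarrow> s \<in> \<rho> \<longleftrightarrow> s' \<in> \<rho>"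
  by (auto simp: central_rel_def)

lemma central_rel_comp:
  assumes "central_rel R" "central_rel R'" shows "central_rel (R O R')" "R \<subseteq> R O R'" "R' \<subseteq> R O R'"
proof -
  have refl: "(s, s) \<in> R" "(s, s) \<in> R'" if "s \<in> S" for s
    using subsetD[of Sat R] subsetD[of Sat R'] that assms Sat_refl by (simp_all add: central_rel_def)
  have sub: "R \<subseteq> S \<times> S" "R' \<subseteq> S \<times> S" using assms by (simp_all add: central_rel_def)
  show RR: "R \<subseteq> R O R'" and "R' \<subseteq> R O R'" using refl sub by blast+
  moreover have "closed_under ar ((A \<otimes> A) \<otimes> (A \<otimes> A)) (R O R')"
    using assms by (intro closed_relcomp[where Y = "A \<otimes> A"]) (simp_all add: central_rel_def)
  moreover have "\<forall>(s, s')\<in>R O R'. s \<in> \<rho> \<longleftrightarrow> s' \<in> \<rho>"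
    using central_rel_rho[OF assms(1)] central_rel_rho[OF assms(2)] by blast
  moreover have "Sat \<subseteq> R O R'" "\<rho> \<times> \<rho> \<subseteq> R O R'"
    using RR assms(1) by (simp_all only: central_rel_def) (metis subset_trans)+
  moreover have "R O R' \<subseteq> S \<times> S" using sub by blast
  ultimately show "central_rel (R O R')" by (simp add: central_rel_def)
qed

lemma central_rel_converse:
  assumes "central_rel R" shows "central_rel (R\<inverse>)"
proof -
  have "Sat \<subseteq> R" "\<rho> \<times> \<rho> \<subseteq> R" "R \<subseteq> S \<times> S" "closed_under ar ((A \<otimes> A) \<otimes> (A \<otimes> A)) R"
    using assms by (simp_all add: central_rel_def)
  moreover have "\<forall>(s, s')\<in>R\<inverse>. s \<in> \<rho> \<longleftrightarrow> s' \<in> \<rho>" using central_rel_rho[OF assms] by blast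
  moreover have "Sat \<subseteq> R\<inverse>" using \<open>Sat \<subseteq> R\<close> Sat_sym by fast
  moreover have "\<rho> \<times> \<rho> \<subseteq> R\<inverse>" using \<open>\<rho> \<times> \<rho> \<subseteq> R\<close> by fast
  moreover have "R\<inverse> \<subseteq> S \<times> S" using \<open>R \<subseteq> S \<times> S\<close> by fast
  ultimately show ?thesis by (simp add: central_rel_def closed_converse)
qed

text \<open>\<open>Opt\<close> is the trace of one bridge \<open>R\<close>, and
  \<open>R O R\<inverse>\<close> is central: the full trace links all of \<open>\<rho>\<close> with
  all of \<open>\<rho>\<close>, and since every element of \<open>S\<close> has an
  \<open>R\<close>-neighbour, closure under \<open>Sat\<close> yields
  \<open>Sat \<subseteq> R O R\<inverse>\<close>.\<close>

lemma ex_central_rel: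
  assumes "Opt ar A \<rho> = one_con A" shows "\<exists>R. central_rel R"
proof -
  obtain R where R: "bridge_rel R" and opt: "Opt ar A \<rho> = {(a, b). ((a, a), (b, b)) \<in> R}"
    using Opt_bridge_rel by blast
  have diag: "((a, a), (b, b)) \<in> R" if "a \<in> univ A" "b \<in> univ A" for a b
  proof -
    have "(a, b) \<in> Opt ar A \<rho>" using that assms by simp
    then show ?thesis unfolding opt by simp
  qed
  have dr: "Domain R = S" "Range R = S" using R by (simp_all add: bridge_rel_def)
  note move = bridge_rel_Sat_closed[OF R]
  have "\<rho> \<times> \<rho> \<subseteq> R"
  proof clarify
    fix a b c d assume ab: "(a, b) \<in> \<rho>" and cd: "(c, d) \<in> \<rho>"
    have A: "a \<in> univ A" "c \<in> univ A" using ab cd rho_equiv equiv_type by blast+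
    \<comment> \<open>Pass from \<open>(a, b)\<close> to \<open>(a, a)\<close> by
      \<open>Sat\<close>, on to \<open>(c, c)\<close> by the full trace, and to
      \<open>(c, d)\<close> by \<open>Sat\<close>.\<close>
    have "((a, b), (a, a)) \<in> Sat" "((c, c), (c, d)) \<in> Sat"
      using ab cd A rho_refl rho_sym S_props by (auto simp: Sat_def)
    then show "((a, b), (c, d)) \<in> R" using move diag A by blast
  qed
  then have "\<rho> \<times> \<rho> \<subseteq> R O R\<inverse>" by blast
  moreover have "Sat \<subseteq> R O R\<inverse>"
  proof clarify
    fix a b c d assume s: "((a, b), (c, d)) \<in> Sat"
    then have "(a, b) \<in> Domain R" using Sat_sub dr by blast
    then obtain t where t: "((a, b), t) \<in> R" by blast
    then have "(t, t) \<in> Sat" using dr Sat_refl by blast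
    then have "((c, d), t) \<in> R" using move t Sat_sym s by blast
    then show "((a, b), (c, d)) \<in> R O R\<inverse>" using t by blast
  qed
  moreover have "closed_under ar ((A \<otimes> A) \<otimes> (A \<otimes> A)) (R O R\<inverse>)"
    using R by (intro closed_relcomp[where Y = "A \<otimes> A"] closed_converse) (simp_all add: bridge_rel_def)
  moreover have "R O R\<inverse> \<subseteq> S \<times> S" using dr by blast
  moreover have "\<forall>(s, s')\<in>R O R\<inverse>. s \<in> \<rho> \<longleftrightarrow> s' \<in> \<rho>"
    using bridge_rel_rho[OF R] by blast
  ultimately have "central_rel (R O R\<inverse>)" by (simp add: central_rel_def)
  then show ?thesis ..
qed

text \<open>A maximal central relation is transitive and symmetric since \<open>\<Theta> O \<Theta>\<close> and \<open>\<Theta> O \<Theta>\<inverse>\<close> are again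
  central.\<close>

lemma ex_maximal_central_rel:
  assumes "Opt ar A \<rho> = one_con A"
  obtains \<Theta> where "central_rel \<Theta>" "equiv S \<Theta>" "\<And>R. central_rel R \<Longrightarrow> \<Theta> \<subseteq> R \<Longrightarrow> R = \<Theta>"
proof -
  have "finite S" using finite_subset[OF S_sub] finite_A by blast
  then have fin: "finite (Collect central_rel)"
    by (intro finite_subset[of "Collect central_rel" "Pow (S \<times> S)"]) (auto simp: central_rel_def)
  obtain R where R: "R \<in> Collect central_rel" using ex_central_rel[OF assms] by blast
  from finite_has_maximal2[OF fin R] obtain \<Theta> where "\<Theta> \<in> Collect central_rel"
    and max: "\<forall>R\<in>Collect central_rel. \<Theta> \<subseteq> R \<longrightarrow> \<Theta> = R"
    by (elim bexE conjE)
  then have \<Theta>: "central_rel \<Theta>" "\<And>R. central_rel R \<Longrightarrow> \<Theta> \<subseteq> R \<Longrightarrow> \<Theta> = R" by simp_all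
  have comp: "\<Theta> O \<Theta> = \<Theta>" 
    by (rule \<Theta>(2)[OF central_rel_comp(1,2)[OF \<Theta>(1) \<Theta>(1)], symmetric])
  note c = central_rel_comp[OF \<Theta>(1) central_rel_converse[OF \<Theta>(1)]]
  have "\<Theta>\<inverse> \<subseteq> \<Theta> O \<Theta>\<inverse>" by (rule c(3))
  also have "\<dots> = \<Theta>" by (rule \<Theta>(2)[OF c(1,2), symmetric])
  finally have conv: "\<Theta>\<inverse> \<subseteq> \<Theta>" .
  have "equiv S \<Theta>"
  proof (rule equivI)
    show "\<Theta> \<subseteq> S \<times> S" using \<Theta>(1) by (simp add: central_rel_def)
    have "Sat \<subseteq> \<Theta>" using \<Theta>(1) by (simp add: central_rel_def)
    then show "refl_on S \<Theta>" using Sat_refl by (blast intro: refl_onI)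
    show "sym \<Theta>" using conv by (blast intro: symI)
    show "trans \<Theta>" using comp by (blast intro: transI)
  qed
  then show thesis by (rule that[OF \<Theta>(1) _ \<Theta>(2)[symmetric]])
qed

end

section \<open>The affine quotient\<close>

text \<open>Each 0-1 word of a Taylor identity is encoded by the set of positions of the letter
  \<open>0\<close>, which are those of \<open>x\<close>.\<close>

lemma taylor_term_split:
  assumes "taylor_term ar A n t" "i < n"
  shows "\<exists>U V. i \<in> U \<and> i \<notin> V \<and> (\<forall>x\<in>univ A. \<forall>y\<in>univ A.
    term_op A t (map (\<lambda>j. if j \<in> U then x else y) [0..<n]) =
    term_op A t (map (\<lambda>j. if j \<in> V then x else y) [0..<n]))"
proof -
  obtain u v :: "nat list" where uv: "length u = n" "length v = n" "set u \<subseteq> {0, 1}" "set v \<subseteq> {0, 1}"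
    "{u ! i, v ! i} = {0, 1}"
    "\<And>x y. x \<in> univ A \<Longrightarrow> y \<in> univ A \<Longrightarrow>
      term_op A t (map (\<lambda>k. [x, y] ! k) u) = term_op A t (map (\<lambda>k. [x, y] ! k) v)"
    using assms unfolding taylor_term_def by metis
  have eq: "map (\<lambda>k. [x, y] ! k) w = map (\<lambda>j. if j \<in> {j. w ! j = 0} then x else y) [0..<n]"
    if "length w = n" "set w \<subseteq> {0, 1}" for w and x y :: 'b
  proof (rule nth_equalityI)
    fix j assume "j < length (map (\<lambda>k. [x, y] ! k) w)"
    then have j: "j < length w" by simp
    then have "w ! j \<in> {0, 1}" using that(2) nth_mem by blast
    then show "map (\<lambda>k. [x, y] ! k) w ! j = map (\<lambda>j. if j \<in> {j. w ! j = 0} then x else y) [0..<n] ! j"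
      using that(1) j by auto
  qed (use that in simp)
  let ?U = "{j. u ! j = 0}" and ?V = "{j. v ! j = 0}"
  have id: "term_op A t (map (\<lambda>j. if j \<in> ?U then x else y) [0..<n]) =
      term_op A t (map (\<lambda>j. if j \<in> ?V then x else y) [0..<n])" if "x \<in> univ A" "y \<in> univ A" for x y
    using uv(6)[OF that] eq[OF uv(1,3), of x y] eq[OF uv(2,4), of x y] by (simp only:)
  \<comment> \<open>The letters at \<open>i\<close> differ, so exactly one of the two sets contains
    \<open>i\<close>; it is taken as \<open>U\<close>, exchanging the sides if necessary.\<close>
  from uv(5) have "i \<in> ?U \<and> i \<notin> ?V \<or> i \<in> ?V \<and> i \<notin> ?U" by (auto simp: doubleton_eq_iff)
  then show ?thesis using id by metis
qed

lemma (in central_congruence) ex_central_maltsev: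
  assumes "finite (univ A)" "has_taylor_term ar A"
  shows "\<exists>p. central_maltsev ar A \<rho> S \<Theta> p"
proof -
  obtain n t where t: "taylor_term ar A n t" using assms(2) by (auto simp: has_taylor_term_def)
  then have n: "n > 1" and wf: "wf_trm ar n t"
    and idem: "\<And>x. x \<in> univ A \<Longrightarrow> term_op A t (replicate n x) = x"
    by (auto simp: taylor_term_def)
  interpret centralized_taylor "univ A" n "\<lambda>u. term_op A t (map u [0..<n])" S \<rho> \<Theta>
  proof
    show "term_op A t (map (\<lambda>_. x) [0..<n]) = x" if "x \<in> univ A" for x
      using idem[OF that] by (simp add: map_replicate_const)
    \<comment> \<open>\<open>\<Theta>\<close> is closed under the operations of the fourth power of
      \<open>A\<close>, hence under \<open>t\<close> applied in all four entries.\<close>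
    show "((term_op A t (map u [0..<n]), term_op A t (map u' [0..<n])),
        (term_op A t (map v [0..<n]), term_op A t (map v' [0..<n]))) \<in> \<Theta>"
      if "\<And>j. j < n \<Longrightarrow> ((u j, u' j), (v j, v' j)) \<in> \<Theta>" for u u' v v'
      using term_op_closed[OF closed wf, of "map (\<lambda>j. ((u j, u' j), (v j, v' j))) [0..<n]"] that wf
      by (auto simp: term_op_prod comp_def image_subset_iff)
    show "(s, s) \<in> \<Theta>" if "s \<in> S" for s
      using equiv that by (simp add: equiv_def refl_on_def)
    show "((a, a), (b, b)) \<in> \<Theta>" if "a \<in> univ A" "b \<in> univ A" for a b
      using that rho_refl rho_rho by blast
    show "s \<in> \<rho> \<longleftrightarrow> s' \<in> \<rho>" if "(s, s') \<in> \<Theta>" for s s'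
      using that rho_class equiv by (meson equiv_def symD)
  qed (use assms n S_sub S_sym rho_equiv Theta_sub taylor_term_split[OF t] in auto)
  obtain g where g: "g \<in> C" "\<forall>(a, b)\<in>S. (g a b b, a) \<in> \<rho> \<and> (g b b a, a) \<in> \<rho>"
    using ex_maltsev_on_S by blast
  obtain p where p: "wf_trm ar 3 p" "\<And>x y z. g x y z = term_op A p [x, y, z]"
    using ternary_clone_term[OF wf g(1)] by blast
  have "central_maltsev ar A \<rho> S \<Theta> p"
    by unfold_locales (use p g C_idem[OF g(1)] in \<open>auto simp flip: p(2)\<close>)
  then show ?thesis ..
qed

theorem theorem6p4:
  fixes ar :: "'f \<Rightarrow> nat" and A :: "('f, 'a) alg" and \<rho> :: "('a \<times> 'a) set"
  assumes "is_algebra ar A" and "finite (univ A)" and "has_taylor_term ar A"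
    and "irreducible_con ar A \<rho>"
    and "Opt ar A \<rho> = one_con A"
  shows "\<exists>(Z :: ('f, 'a) sq_quot) z\<^sub>0 \<zeta>.
           in_HS ar (A \<otimes> A) Z \<and> simple_alg ar Z \<and> affine ar Z \<and>
           subuniverse ar Z {z\<^sub>0} \<and>
           subdirect3 ar A A Z \<zeta> \<and>
           pr12 \<zeta> = star ar A \<rho> \<and>
           (\<forall>a a' b. (a, a', b) \<in> \<zeta> \<longrightarrow> ((a, a') \<in> \<rho> \<longleftrightarrow> b = z\<^sub>0))"
proof -
  define S where "S = star ar A \<rho>"
  interpret irreducible_congruence ar A \<rho> S
    by unfold_locales (use assms S_def in auto)
  obtain \<Theta> where \<Theta>: "central_rel \<Theta>" "equiv S \<Theta>" "\<And>R. central_rel R \<Longrightarrow> \<Theta> \<subseteq> R \<Longrightarrow> R = \<Theta>"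
    using ex_maximal_central_rel[OF assms(5)] by blast
  interpret Q: central_congruence ar A \<rho> S \<Theta>
  proof
    show "(b, a) \<in> S" if "(a, b) \<in> S" for a b using that S_converse by blast
    show "((a, b), (c, d)) \<in> \<Theta>" if "(a, b) \<in> S" "(a, c) \<in> \<rho>" "(b, d) \<in> \<rho>" for a b c d
      using that \<Theta>(1) by (auto simp: central_rel_def Sat_def)
  qed (use assms(1) rho_Con S_props \<Theta> in \<open>auto simp: central_rel_def\<close>)
  obtain p where "central_maltsev ar A \<rho> S \<Theta> p"
    using Q.ex_central_maltsev[OF assms(2,3)] by blast
  then interpret Q: central_maltsev ar A \<rho> S \<Theta> p .
  have simple: "simple_alg ar Q.Z"
  proof (rule Q.simple_Z)
    show "R = S" if "subuniverse ar (A \<otimes> A) R" "saturated \<rho> R" "\<rho> \<subset> R" "R \<subseteq> S" for R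
      using S_minimal that by blast
    show "\<Theta>' = \<Theta>" if "equiv S \<Theta>'" "closed_under ar ((A \<otimes> A) \<otimes> (A \<otimes> A)) \<Theta>'" "\<Theta> \<subseteq> \<Theta>'"
      "\<forall>(s, s')\<in>\<Theta>'. s \<in> \<rho> \<longrightarrow> s' \<in> \<rho>" for \<Theta>'
    proof (rule \<Theta>(3)[OF _ that(3)])
      \<comment> \<open>Symmetry turns the one-sided condition on \<open>\<rho>\<close> into the
        two-sided one of \<open>central_rel\<close>.\<close>
      have "sym \<Theta>'" using that(1) by (simp add: equiv_def)
      then have "\<forall>(s, s')\<in>\<Theta>'. s \<in> \<rho> \<longleftrightarrow> s' \<in> \<rho>" using that(4) by (blast dest: symD)
      then show "central_rel \<Theta>'"
        using \<Theta>(1) that(2,3) equiv_type[OF that(1)] unfolding central_rel_def by blast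
    qed
  qed
  define \<zeta> where "\<zeta> = {(a, a', Q.cls (a, a')) | a a'. (a, a') \<in> S}"
  have pr: "pr12 \<zeta> = S" by (force simp: pr12_def \<zeta>_def)
  have "subdirect3 ar A A Q.Z \<zeta>"
    unfolding subdirect3_def subuniverse_def
  proof (intro conjI)
    show "\<zeta> \<subseteq> univ (A \<otimes> A \<otimes> Q.Z)" using S_sub by (auto simp: \<zeta>_def Q.univ_Z)
    show "closed_under ar (A \<otimes> A \<otimes> Q.Z) \<zeta>"
      unfolding closed_under_def
    proof (intro allI impI, elim conjE)
      fix f xs assume xs: "length xs = ar f" "set xs \<subseteq> \<zeta>"
      define ss where "ss = map (\<lambda>x. (fst x, fst (snd x))) xs"
      have ss: "length ss = ar f" "set ss \<subseteq> S" using xs by (auto simp: ss_def \<zeta>_def)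
      have eq: "map (\<lambda>x. snd (snd x)) xs = map Q.cls ss" using xs by (auto simp: ss_def \<zeta>_def)
      have "interp (A \<otimes> A \<otimes> Q.Z) f xs =
          (interp A f (map fst ss), interp A f (map snd ss), interp Q.Z f (map (\<lambda>x. snd (snd x)) xs))"
        by (simp add: ss_def comp_def)
      also have "\<dots> = (interp A f (map fst ss), interp A f (map snd ss), Q.cls (interp (A \<otimes> A) f ss))"
        by (simp only: eq Q.interp_Z[OF ss])
      also have "\<dots> \<in> \<zeta>" using closed_underD[OF S_closed ss] by (auto simp: \<zeta>_def)
      finally show "interp (A \<otimes> A \<otimes> Q.Z) f xs \<in> \<zeta>" .
    qed
    \<comment> \<open>The first two projections are onto because \<open>S\<close> contains the
      diagonal.\<close>
    show "(\<lambda>(a, b, c). a) ` \<zeta> = univ A"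
      using S_sub Q.S_refl by (force simp: \<zeta>_def image_iff)
    show "(\<lambda>(a, b, c). b) ` \<zeta> = univ A"
      using S_sub Q.S_refl by (force simp: \<zeta>_def image_iff)
    show "(\<lambda>(a, b, c). c) ` \<zeta> = univ Q.Z"
      by (force simp: \<zeta>_def image_iff Q.univ_Z)
  qed
  moreover have "\<forall>a a' b. (a, a', b) \<in> \<zeta> \<longrightarrow> ((a, a') \<in> \<rho> \<longleftrightarrow> b = \<rho>)"
    using Q.cls_eq_rho by (auto simp: \<zeta>_def)
  ultimately show ?thesis
    using Q.in_HS_Z simple Q.affine_Z Q.subuniverse_rho pr unfolding S_def by blast
qed

end
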